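(* For $q=e^{2\pi i\tau}$ with $\operatorname{Im}(\tau)>0$, the following identities hold: \begin{align*} \frac12\xi_{R}(q)+2A_2(-q)&=\frac14\frac{\Theta_{1}^5}{\Theta_{2}^4},\\ \frac12\xi_{R}(q)-\frac12\mu_2(q)&=-\frac14\frac{\Theta_{1}^5}{\Theta_{2}^4},\\ \frac12\xi_{R}(q)-\frac14\mu_2(q)+A_2(-q)&=0. \end{align*}
   Context: Here $q=e^{2\pi i\tau}$, $\operatorname{Im}(\tau)>0$ (so $0<|q|<1$). Notation: $(x;q)_n=\prod_{i=0}^{n-1}(1-q^ix)$, $(x)_n=(x;q)_n$, and $\Theta_m=\prod_{i\ge1}(1-q^{mi})$ for positive integers $m$. The function $\xi_R$ is $$\xi_{R}(q)={\sum_{n\ge0}}^{*}\frac{(-1)^n(q;q^2)_n}{(-q)_{n}^2}=\frac12+\frac12\sum_{n\ge0}\frac{(-1)^{n}q^{n+1}(q;q^2)_n(2+q^n+q^{n+1})}{(-q)_{n+1}^2},$$ where $\sum^{*}$ denotes the average of the limit of the even-indexed partial sums and the limit of the odd-indexed partial sums (both limits exist, although the series itself does not converge). The second-order mock theta functions $A_2,\mu_2$ are $$A_2(q)=\sum_{n\ge0}\frac{q^{n+1}(-q^2;q^2)_n}{(q;q^2)_{n+1}}=\sum_{n\ge0}\frac{q^{(n+1)^2}(-q;q^2)_n}{(q;q^2)_{n+1}^2},\qquad \mu_2(q)=\sum_{n\ge0}\frac{(-1)^nq^{n^2}(q;q^2)_n}{(-q^2;q^2)_n^2}.$$ *)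

theory Defs
  imports "HOL-Analysis.Analysis"
begin

definition qpoch :: "complex \<Rightarrow> complex \<Rightarrow> nat \<Rightarrow> complex" where
  "qpoch x q n = (\<Prod>i<n. 1 - q ^ i * x)"

definition Theta :: "nat \<Rightarrow> complex \<Rightarrow> complex" where
  "Theta m q = prodinf (\<lambda>i. 1 - q ^ (m * Suc i))"

text \<open>The starred sum: the average of the limit of the even-indexed and the limit of the
  odd-indexed partial sums. It is meaningful only when both limits exist.\<close>

definition star_sum :: "(nat \<Rightarrow> complex) \<Rightarrow> complex" where
  "star_sum a = (lim (\<lambda>N. \<Sum>n\<le>2 * N. a n) + lim (\<lambda>N. \<Sum>n\<le>2 * N + 1. a n)) / 2"

definition xi_R :: "complex \<Rightarrow> complex" where
  "xi_R q = star_sum (\<lambda>n. (-1) ^ n * qpoch q (q ^ 2) n / qpoch (- q) q n ^ 2)"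

definition A2 :: "complex \<Rightarrow> complex" where
  "A2 q = (\<Sum>n. q ^ (n + 1) * qpoch (- (q ^ 2)) (q ^ 2) n / qpoch q (q ^ 2) (n + 1))"

definition mu2 :: "complex \<Rightarrow> complex" where
  "mu2 q = (\<Sum>n. (-1) ^ n * q ^ (n ^ 2) * qpoch q (q ^ 2) n / qpoch (- (q ^ 2)) (q ^ 2) n ^ 2)"

end

theory Submission
  imports Defs "HOL-Library.Nat_Bijection"
begin

text \<open>All three functions are, up to the same infinite product, pieces of one series. Let
  \<open>\<alpha>\<^sub>0 = 1\<close> and \<open>\<alpha>\<^sub>r = 4 (- 1)\<^sup>r q\<^bsup>r (r + 1) / 2\<^esup> / (1 + q\<^sup>r)\<close> for \<open>r > 0\<close>, let \<open>E\<close> and \<open>O\<close> be the sums of \<open>\<alpha>\<^sub>r\<close> over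
  the even and over the odd \<open>r\<close>, and let \<open>C = (q; q\<^sup>2)\<^sub>\<infinity> / (q\<^sup>2; q\<^sup>2)\<^sub>\<infinity> = \<Theta>\<^sub>1 / \<Theta>\<^sub>2\<^sup>2\<close>. Then

  \<^item> \<open>\<xi>\<^sub>R(q) = C (E - O) / 2\<close> (lemma \<open>xi_R_eq\<close>),
  \<^item> \<open>\<mu>\<^sub>2(q) = C E\<close> (lemma \<open>mu2_eq\<close>),
  \<^item> \<open>A\<^sub>2(- q) = C O / 4\<close> (lemma \<open>A2_minus_eq\<close>),
  \<^item> \<open>E + O = (q; q)\<^sub>\<infinity>\<^sup>2 / (- q; q)\<^sub>\<infinity>\<^sup>2 = \<Theta>\<^sub>1\<^sup>4 / \<Theta>\<^sub>2\<^sup>2\<close> (lemma \<open>suminf_pf_coeff\<close>),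

  and the three identities are linear consequences of these equations.

  The first three equations are instances of Bailey's lemma. The numbers \<open>1 / (- q; q)\<^sub>n\<^sup>2\<close> and
  \<open>1 / (- q; q\<^sup>2)\<^sub>n\<^sub>+\<^sub>1\<^sup>2\<close> are values of rational functions whose partial fraction expansions are Bailey pairs (lemmas \<open>bailey_pair_0\<close> and
  \<open>bailey_pair_1\<close>), and the sums over \<open>n\<close> that arise on interchanging summations are evaluated by the
  \<open>q\<close>-Gauss sum. For \<open>\<xi>\<^sub>R\<close> the argument of the \<open>q\<close>-Gauss series is \<open>- 1\<close>, on the boundary of convergence; therefore
  the \<open>q\<close>-Gauss sum (\<open>q_gauss_averaged\<close>) and Bailey's lemma (\<open>bailey_lemma_averaged\<close>) are proved for
  means of consecutive partial sums, which agree with the starred sum in the divergent case and with the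
  ordinary sum otherwise. The series that defines \<open>A\<^sub>2\<close> is not of the form required by Bailey's lemma and is brought into
  it by a transformation of Fine (\<open>fine_transformation\<close>). The fourth equation is the limit \<open>n \<rightarrow> \<infinity>\<close> of the
  first of the two expansions.\<close>

section \<open>Shifted factorials\<close>

lemma qpoch_0 [simp]: "qpoch x q 0 = 1"
  by (simp add: qpoch_def)

lemma qpoch_Suc: "qpoch x q (Suc n) = qpoch x q n * (1 - q ^ n * x)"
  by (simp add: qpoch_def)

lemma qpoch_add: "qpoch x q (m + n) = qpoch x q m * qpoch (q ^ m * x) q n"
  by (induction n) (simp_all add: qpoch_Suc power_add mult_ac)

lemma qpoch_nonzero_iff: "qpoch x q n \<noteq> 0 \<longleftrightarrow> (\<forall>i<n. q ^ i * x \<noteq> 1)"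
  by (auto simp: qpoch_def)

lemma norm_power_mult_less_1:
  fixes q x :: complex
  assumes "norm q \<le> 1" "norm x < 1"
  shows "norm (q ^ i * x) < 1"
proof -
  have "norm q ^ i * norm x \<le> 1 * norm x"
    by (intro mult_right_mono power_le_one) (use assms in auto)
  thus ?thesis using assms by (simp add: norm_mult norm_power)
qed

lemma one_plus_nonzero: "norm (x :: complex) < 1 \<Longrightarrow> 1 + x \<noteq> 0"
  by (metis add_eq_0_iff norm_minus_cancel norm_one order_less_irrefl)

lemma qpoch_nonzero: "norm q \<le> 1 \<Longrightarrow> norm x < 1 \<Longrightarrow> qpoch x q n \<noteq> 0"
  unfolding qpoch_nonzero_iff using norm_power_mult_less_1[of q x] by (metis norm_one order_less_irrefl)

lemma qpoch_minus_one_factor_nonzero: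
  fixes q :: complex
  assumes "norm q < 1"
  shows "q ^ i * (- 1) \<noteq> 1"
proof (cases i)
  case (Suc j)
  have "norm (q ^ i) < 1"
    using assms power_less_one_iff[of "norm q" i] Suc by (simp add: norm_power del: power_Suc)
  thus ?thesis by (metis mult_minus1_right norm_minus_cancel norm_one order_less_irrefl)
qed auto

text \<open>The infinite \<open>q\<close>-shifted factorial \<open>(x; q)\<^sub>\<infinity>\<close>, with the arguments in the order of \<^const>\<open>qpoch\<close>. It is the limit of
  the finite factorials as long as no factor vanishes.\<close>
definition qpoch_inf :: "complex \<Rightarrow> complex \<Rightarrow> complex" where
  "qpoch_inf x q = prodinf (\<lambda>i. 1 - q ^ i * x)"

lemma qpoch_inf_convergent:
  fixes q x :: complex
  assumes "norm q < 1" "\<And>i. q ^ i * x \<noteq> 1"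
  shows "convergent_prod (\<lambda>i. 1 - q ^ i * x)"
proof -
  have "convergent_prod (\<lambda>i. 1 + (- (q ^ i * x)))"
  proof (rule summable_imp_convergent_prod_complex[where z = "\<lambda>i. - (q ^ i * x)"])
    show "summable (\<lambda>k. norm (- (q ^ k * x)))"
      using assms(1) by (simp add: norm_mult norm_power summable_mult2 summable_geometric)
  qed (use assms(2) in auto)
  thus ?thesis by simp
qed

lemma qpoch_tendsto:
  assumes "norm q < 1" "\<And>i. q ^ i * x \<noteq> 1"
  shows "qpoch x q \<longlonglongrightarrow> qpoch_inf x q"
proof -
  have "(\<lambda>n. qpoch x q (Suc n)) \<longlonglongrightarrow> qpoch_inf x q"
    using convergent_prod_LIMSEQ[OF qpoch_inf_convergent[OF assms]]
    by (simp add: qpoch_def qpoch_inf_def lessThan_Suc_atMost)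
  thus ?thesis by (rule LIMSEQ_imp_Suc)
qed

lemma qpoch_inf_nonzero:
  assumes "norm q < 1" "\<And>i. q ^ i * x \<noteq> 1"
  shows "qpoch_inf x q \<noteq> 0"
  unfolding qpoch_inf_def
  by (rule prodinf_nonzero[OF qpoch_inf_convergent[OF assms]]) (use assms(2) in auto)

lemma qpoch_tendsto':
  assumes "norm q < 1" "norm x < 1"
  shows "qpoch x q \<longlonglongrightarrow> qpoch_inf x q" "qpoch_inf x q \<noteq> 0"
proof -
  have "q ^ i * x \<noteq> 1" for i
    using norm_power_mult_less_1[of q x i] assms by auto
  thus "qpoch x q \<longlonglongrightarrow> qpoch_inf x q" "qpoch_inf x q \<noteq> 0"
    using qpoch_tendsto qpoch_inf_nonzero assms by blast+
qed

text \<open>A lower bound for \<open>(c; q)\<^sub>n\<close> that is uniform in both \<open>c\<close> and \<open>n\<close>: replacing \<open>q\<close> and \<open>c\<close> by \<open>\<bar>q\<bar>\<close> can only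
  decrease each factor, and the resulting real products stay away from \<open>0\<close>.\<close>
lemma qpoch_lower_bound:
  assumes "norm q < 1"
  obtains k where "k > 0" "\<And>c n. norm c \<le> norm q \<Longrightarrow> k \<le> norm (qpoch c q n)"
proof -
  define a where "a = complex_of_real (norm q)"
  have a: "norm a = norm q" "norm a < 1" using assms by (simp_all add: a_def)
  have "(\<lambda>n. inverse (qpoch a a n)) \<longlonglongrightarrow> inverse (qpoch_inf a a)"
    using qpoch_tendsto'[of a a] a by (intro tendsto_inverse) auto
  then obtain K where K: "K > 0" "\<And>n. norm (inverse (qpoch a a n)) \<le> K"
    using BseqE[OF convergent_imp_Bseq[OF convergentI]] by metis
  have le: "1 / K \<le> norm (qpoch a a n)" for n
    using K(2)[of n] K(1) qpoch_nonzero[of a a n] a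
    by (simp add: norm_inverse norm_divide field_simps)
  have "norm (qpoch a a n) \<le> norm (qpoch c q n)" if "norm c \<le> norm q" for c n
    unfolding qpoch_def prod_norm[symmetric]
  proof (intro prod_mono conjI)
    fix i
    have "norm q ^ Suc i \<le> 1"
      using assms by (intro power_le_one) auto
    moreover have "1 - a ^ i * a = of_real (1 - norm q ^ Suc i)"
      by (simp add: a_def)
    ultimately have "norm (1 - a ^ i * a) = 1 - norm q ^ Suc i"
      by (metis abs_of_nonneg diff_ge_0_iff_ge norm_of_real)
    also have "\<dots> \<le> 1 - norm (q ^ i * c)"
      using that by (simp add: norm_mult norm_power mult_left_mono mult.commute[of "norm q"])
    also have "\<dots> \<le> norm (1 - q ^ i * c)"
      by (metis norm_one norm_triangle_ineq2)
    finally show "norm (1 - a ^ i * a) \<le> norm (1 - q ^ i * c)" .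
  qed auto
  with le have "1 / K \<le> norm (qpoch c q n)" if "norm c \<le> norm q" for c n
    using that order_trans by blast
  thus ?thesis using that[of "1 / K"] K(1) by auto
qed

text \<open>The numerators of all the series below are products of quadratic factors of this shape. The bound
  depends on \<open>s\<close> only through its norm and requires no more than \<open>\<bar>t\<bar> \<le> 1\<close>.\<close>
lemma norm_qpoch_numerator_le:
  fixes p s c t :: complex
  assumes "norm p < 1" "norm t \<le> 1" "norm c \<le> 1"
  shows "norm (\<Prod>i<m. t - s * p ^ i + c * p ^ (2 * i)) \<le> exp ((norm s + 1) / (1 - norm p))"
proof -
  have "norm (t - s * p ^ i + c * p ^ (2 * i)) \<le> 1 + (norm s + 1) * norm p ^ i" for i
  proof -
    have "norm (t - s * p ^ i + c * p ^ (2 * i)) \<le>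
        norm t + norm (s * p ^ i) + norm (c * p ^ (2 * i))"
      by (metis add_right_mono norm_triangle_ineq norm_triangle_ineq4 order_trans)
    also have "norm (c * p ^ (2 * i)) \<le> 1 * norm p ^ i"
      unfolding norm_mult norm_power
      by (intro mult_mono power_decreasing) (use assms in auto)
    finally show ?thesis using assms by (simp add: norm_mult norm_power algebra_simps)
  qed
  hence "norm (\<Prod>i<m. t - s * p ^ i + c * p ^ (2 * i)) \<le> (\<Prod>i<m. 1 + (norm s + 1) * norm p ^ i)"
    unfolding prod_norm[symmetric] by (intro prod_mono) auto
  also have "\<dots> \<le> exp (\<Sum>i<m. (norm s + 1) * norm p ^ i)"
    by (intro prod_le_exp_sum) auto
  also have "(\<Sum>i<m. (norm s + 1) * norm p ^ i) \<le> (norm s + 1) * (1 / (1 - norm p))"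
  proof -
    have "(\<Sum>i<m. norm p ^ i) \<le> (\<Sum>i. norm p ^ i)"
      by (intro sum_le_suminf) (use assms in \<open>auto simp: summable_geometric\<close>)
    also have "\<dots> = 1 / (1 - norm p)"
      using assms by (simp add: suminf_geometric)
    finally show ?thesis
      unfolding sum_distrib_left[symmetric] by (intro mult_left_mono) auto
  qed
  finally show ?thesis by simp
qed

lemma norm_one_minus_ge:
  fixes p c :: complex
  assumes "norm c \<le> norm p"
  shows "1 - norm p \<le> norm (1 - c)"
  by (metis assms diff_left_mono norm_one norm_triangle_ineq2 order_trans)

lemma power_neq_1:
  fixes p c :: complex
  assumes "norm p < 1" "norm c \<le> norm p"
  shows "\<And>i. c * p ^ i \<noteq> 1" "\<And>i. p ^ Suc i \<noteq> 1"
proof -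
  fix i
  show "c * p ^ i \<noteq> 1"
    using norm_power_mult_less_1[of p c i] assms by (auto simp: mult.commute)
  show "p ^ Suc i \<noteq> 1"
    using norm_power_mult_less_1[of p p i] assms by (auto simp: mult.commute)
qed

lemma qpoch_base_Suc: "qpoch q q (Suc n) = qpoch q q n * (1 - q ^ Suc n)"
  by (simp add: qpoch_Suc mult.commute)

lemma norm_qpoch_le:
  assumes "norm p < 1"
  shows "norm (qpoch x p n) \<le> exp ((norm x + 1) / (1 - norm p))"
  using norm_qpoch_numerator_le[OF assms, of 1 0 x n] by (simp add: qpoch_def mult.commute)

lemma qpoch_inf_0 [simp]: "qpoch_inf 0 p = 1"
  by (simp add: qpoch_inf_def)

lemma norm_square_less_1: "norm (q :: complex) < 1 \<Longrightarrow> norm (q ^ 2) < 1"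
  by (simp add: norm_power power_less_one_iff)

lemma qpoch_inf_products:
  assumes q: "norm q < 1"
  shows "qpoch_inf q (q ^ 2) * qpoch_inf (q ^ 2) (q ^ 2) = qpoch_inf q q"
    and "qpoch_inf q q * qpoch_inf (- q) q = qpoch_inf (q ^ 2) (q ^ 2)"
    and "qpoch_inf (- 1) q = 2 * qpoch_inf (- q) q"
proof -
  note q2 = norm_square_less_1[OF q]
  have eq1: "qpoch q q (2 * n) = qpoch q (q ^ 2) n * qpoch (q ^ 2) (q ^ 2) n" for n
  proof (induction n)
    case (Suc n)
    have "q ^ (2 * n) = (q ^ 2) ^ n" by (rule power_mult)
    moreover have "qpoch q q (2 * Suc n) = qpoch q q (2 * n) * (1 - q ^ (2 * n) * q) * (1 - q ^ (2 * n) * q ^ 2)"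
      by (simp add: qpoch_Suc power2_eq_square mult_ac)
    ultimately show ?case by (simp only: Suc.IH qpoch_Suc) (simp only: mult_ac)
  qed simp
  have "(\<lambda>n. qpoch q q (2 * n)) \<longlonglongrightarrow> qpoch_inf q q"
    using LIMSEQ_subseq_LIMSEQ[OF qpoch_tendsto'(1)[OF q q], of "\<lambda>n. 2 * n"]
    by (simp add: o_def strict_mono_def)
  moreover have "(\<lambda>n. qpoch q (q ^ 2) n * qpoch (q ^ 2) (q ^ 2) n) \<longlonglongrightarrow>
      qpoch_inf q (q ^ 2) * qpoch_inf (q ^ 2) (q ^ 2)"
    by (intro tendsto_mult qpoch_tendsto' q q2)
  ultimately show "qpoch_inf q (q ^ 2) * qpoch_inf (q ^ 2) (q ^ 2) = qpoch_inf q q"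
    unfolding eq1 by (rule LIMSEQ_unique[rotated])
  have eq2: "qpoch q q n * qpoch (- q) q n = qpoch (q ^ 2) (q ^ 2) n" for n
  proof (induction n)
    case (Suc n)
    have "(1 - q ^ n * q) * (1 - q ^ n * (- q)) = 1 - (q ^ n) ^ 2 * q ^ 2"
      by (simp add: power2_eq_square algebra_simps)
    also have "(q ^ n) ^ 2 = (q ^ 2) ^ n"
      by (simp add: power_mult[symmetric] mult.commute)
    finally have "qpoch q q (Suc n) * qpoch (- q) q (Suc n) =
        (qpoch q q n * qpoch (- q) q n) * (1 - (q ^ 2) ^ n * q ^ 2)"
      by (simp only: qpoch_Suc mult_ac)
    thus ?case by (simp only: Suc.IH qpoch_Suc)
  qed simp
  have "(\<lambda>n. qpoch q q n * qpoch (- q) q n) \<longlonglongrightarrow> qpoch_inf q q * qpoch_inf (- q) q"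
    using qpoch_tendsto'(1)[OF q, of "- q"] q by (intro tendsto_mult qpoch_tendsto' q) auto
  thus "qpoch_inf q q * qpoch_inf (- q) q = qpoch_inf (q ^ 2) (q ^ 2)"
    unfolding eq2 using qpoch_tendsto'(1)[OF q2 q2] by (rule LIMSEQ_unique)
  have eq3: "qpoch (- 1) q (n + 1) = 2 * qpoch (- q) q n" for n
    using qpoch_add[of "- 1" q 1 n] by (simp add: qpoch_Suc[of "- 1" q 0])
  have "(\<lambda>n. qpoch (- 1) q (n + 1)) \<longlonglongrightarrow> qpoch_inf (- 1) q"
    by (intro LIMSEQ_ignore_initial_segment qpoch_tendsto q qpoch_minus_one_factor_nonzero)
  moreover have "(\<lambda>n. 2 * qpoch (- q) q n) \<longlonglongrightarrow> 2 * qpoch_inf (- q) q"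
    using q by (intro tendsto_mult tendsto_const qpoch_tendsto') auto
  ultimately show "qpoch_inf (- 1) q = 2 * qpoch_inf (- q) q"
    unfolding eq3 by (rule LIMSEQ_unique)
qed

section \<open>Series and means of partial sums\<close>

lemma tendsto_power_0:
  fixes p :: complex
  assumes "norm p < 1"
  shows "(\<lambda>n. p ^ n) \<longlonglongrightarrow> 0" "(\<lambda>n. p ^ (2 * n)) \<longlonglongrightarrow> 0"
proof -
  show "(\<lambda>n. p ^ n) \<longlonglongrightarrow> 0" using assms by (rule LIMSEQ_power_zero)
  have "norm (p ^ 2) < 1" using assms by (simp add: norm_power power_less_one_iff)
  from LIMSEQ_power_zero[OF this] show "(\<lambda>n. p ^ (2 * n)) \<longlonglongrightarrow> 0"
    by (simp add: power_mult)
qed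

lemma summable_ratio_limit:
  fixes a \<rho> :: "nat \<Rightarrow> complex"
  assumes "\<And>n. a (Suc n) = \<rho> n * a n" "\<rho> \<longlonglongrightarrow> l" "norm l < 1"
  shows "summable a"
proof -
  obtain r where r: "norm l < r" "r < 1" using dense[OF assms(3)] by blast
  have "\<forall>\<^sub>F n in sequentially. norm (\<rho> n) < r"
    using tendsto_norm[OF assms(2)] r(1) by (rule order_tendstoD)
  then obtain N where N: "\<And>n. n \<ge> N \<Longrightarrow> norm (\<rho> n) < r"
    by (auto simp: eventually_at_top_linorder)
  show ?thesis
  proof (rule summable_ratio_test[OF r(2), of N])
    fix n assume "n \<ge> N"
    from N[OF this] show "norm (a (Suc n)) \<le> r * norm (a n)"
      unfolding assms(1) norm_mult by (intro mult_right_mono) auto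
  qed
qed

lemma suminf_even_odd:
  fixes f :: "nat \<Rightarrow> complex"
  assumes f: "\<And>n. norm (f n) \<le> K * x ^ n" and x: "0 \<le> x" "x < 1"
  shows "summable (\<lambda>n. norm (f n))"
    and "(\<Sum>n. f n) = (\<Sum>n. f (2 * n)) + (\<Sum>n. f (2 * n + 1))"
    and "(\<Sum>n. (- 1) ^ n * f n) = (\<Sum>n. f (2 * n)) - (\<Sum>n. f (2 * n + 1))"
proof -
  have K: "K \<ge> 0" using order_trans[OF norm_ge_zero f[of 0]] by simp
  have geo: "summable (\<lambda>n. K * x ^ n)"
    using x by (intro summable_mult summable_geometric) auto
  show sf: "summable (\<lambda>n. norm (f n))"
    by (rule summable_comparison_test'[OF geo]) (use f in auto)
  have "norm (f (2 * n)) \<le> K * x ^ n" "norm (f (2 * n + 1)) \<le> K * x ^ n" for n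
    using order_trans[OF f[of "2 * n"], of "K * x ^ n"] order_trans[OF f[of "2 * n + 1"], of "K * x ^ n"]
      power_decreasing[of n "2 * n" x] power_decreasing[of n "2 * n + 1" x] x K
    by (auto intro!: mult_left_mono simp del: power_Suc)
  hence eo: "summable (\<lambda>n. f (2 * n))" "summable (\<lambda>n. f (2 * n + 1))"
    by (auto intro!: summable_comparison_test'[OF geo])
  have group: "(\<Sum>n. g n) = (\<Sum>n. g (2 * n) + g (2 * n + 1))" if "summable g" for g :: "nat \<Rightarrow> complex"
  proof -
    have "(\<lambda>n. sum g {n * 2..<n * 2 + 2}) sums (\<Sum>n. g n)"
      by (rule sums_group) (use that in \<open>auto intro: summable_sums\<close>)
    moreover have "sum g {n * 2..<n * 2 + 2} = g (2 * n) + g (2 * n + 1)" for n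
      by (simp add: numeral_2_eq_2 mult.commute)
    ultimately show ?thesis by (simp add: sums_iff)
  qed
  show "(\<Sum>n. f n) = (\<Sum>n. f (2 * n)) + (\<Sum>n. f (2 * n + 1))"
    unfolding group[OF summable_norm_cancel[OF sf]] by (rule suminf_add[OF eo, symmetric])
  have "summable (\<lambda>n. (- 1) ^ n * f n)"
    by (rule summable_norm_cancel) (use sf in \<open>simp add: norm_mult norm_power\<close>)
  from group[OF this] show "(\<Sum>n. (- 1) ^ n * f n) = (\<Sum>n. f (2 * n)) - (\<Sum>n. f (2 * n + 1))"
    using suminf_diff[OF eo] by simp
qed

lemma suminf_eq_averaged_limit:
  fixes a :: "nat \<Rightarrow> complex"
  assumes "summable a" "(\<lambda>N. ((\<Sum>n<N. a n) + (\<Sum>n<Suc N. a n)) / 2) \<longlonglongrightarrow> L"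
  shows "(\<Sum>n. a n) = L"
proof -
  have "(\<lambda>N. ((\<Sum>n<N. a n) + (\<Sum>n<Suc N. a n)) / 2) \<longlonglongrightarrow> ((\<Sum>n. a n) + (\<Sum>n. a n)) / 2"
    using summable_LIMSEQ[OF assms(1)] LIMSEQ_Suc[OF summable_LIMSEQ[OF assms(1)]]
    by (intro tendsto_intros) auto
  from LIMSEQ_unique[OF this assms(2)] show ?thesis by simp
qed

text \<open>If the terms of odd index converge, then so do the partial sums of even and of odd index, and their
  mean limit is the limit of the means of consecutive partial sums.\<close>
lemma star_sum_eq_averaged_limit:
  assumes avg: "(\<lambda>N. ((\<Sum>n<N. a n) + (\<Sum>n<Suc N. a n)) / 2) \<longlonglongrightarrow> L"
    and a: "(\<lambda>N. a (2 * N + 1)) \<longlonglongrightarrow> l"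
  shows "star_sum a = L"
proof -
  define A where "A = (\<lambda>N. ((\<Sum>n<N. a n) + (\<Sum>n<Suc N. a n)) / 2)"
  have A: "(\<lambda>N. A (2 * N + 1)) \<longlonglongrightarrow> L"
    using LIMSEQ_subseq_LIMSEQ[OF avg, of "\<lambda>N. 2 * N + 1"] by (simp add: A_def o_def strict_mono_def)
  have "(\<Sum>n\<le>2 * N. a n) = A (2 * N + 1) - a (2 * N + 1) / 2"
    "(\<Sum>n\<le>2 * N + 1. a n) = A (2 * N + 1) + a (2 * N + 1) / 2" for N
    by (simp_all add: A_def lessThan_Suc_atMost field_simps)
  hence "(\<lambda>N. \<Sum>n\<le>2 * N. a n) \<longlonglongrightarrow> L - l / 2" "(\<lambda>N. \<Sum>n\<le>2 * N + 1. a n) \<longlonglongrightarrow> L + l / 2"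
    by (simp_all only:) (intro tendsto_intros A a; simp)+
  thus ?thesis unfolding star_sum_def by (simp add: limI)
qed

section \<open>The q-Gauss sum\<close>

text \<open>The terms of the \<open>q\<close>-Gauss series \<open>\<Sum>\<^sub>m (a)\<^sub>m (b)\<^sub>m (c / a b)\<^sup>m / ((p)\<^sub>m (c)\<^sub>m)\<close> to the base \<open>p\<close>. The parameters \<open>a\<close> and \<open>b\<close>
  enter through \<open>t = c / (a b)\<close> and \<open>s = c (1 / a + 1 / b)\<close> alone, because
  \<open>(c / a b) (1 - a x) (1 - b x) = t - s x + c x\<^sup>2\<close>. This avoids square roots when \<open>a = - b\<close>, and it makes the
  confluent case \<open>b = \<infinity>\<close> an ordinary value, namely \<open>t = 0\<close>.\<close>
definition gauss_term :: "complex \<Rightarrow> complex \<Rightarrow> complex \<Rightarrow> complex \<Rightarrow> nat \<Rightarrow> complex" where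
  "gauss_term p c s t m =
     (\<Prod>i<m. (t - s * p ^ i + c * p ^ (2 * i)) / ((1 - p ^ Suc i) * (1 - c * p ^ i)))"

lemma gauss_term_0 [simp]: "gauss_term p c s t 0 = 1"
  by (simp add: gauss_term_def)

lemma gauss_term_Suc: "gauss_term p c s t (Suc m) = gauss_term p c s t m *
    ((t - s * p ^ m + c * p ^ (2 * m)) / ((1 - p ^ Suc m) * (1 - c * p ^ m)))"
  by (simp add: gauss_term_def)

lemma gauss_term_shift:
  assumes "\<And>i. c * p ^ i \<noteq> 1" "\<And>i. p ^ Suc i \<noteq> 1"
  shows "gauss_term p (c * p) (s * p) (t * p) m = gauss_term p c s t m * (p ^ m * (1 - c) / (1 - c * p ^ m))"
proof (induction m)
  case 0
  show ?case using assms(1)[of 0] by simp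
next
  case (Suc m)
  have nz: "1 - c * p ^ m \<noteq> 0" "1 - c * p ^ Suc m \<noteq> 0" "1 - p ^ Suc m \<noteq> 0"
    using assms(1)[of m] assms(1)[of "Suc m"] assms(2)[of m] by auto
  have *: "c * p * p ^ m = c * p ^ Suc m" by simp
  show ?case
    unfolding gauss_term_Suc Suc *
    using nz by (simp add: divide_simps del: power_Suc) (simp add: algebra_simps)
qed

text \<open>The first-order recurrence behind the \<open>q\<close>-Gauss sum relates \<open>c\<close> to \<open>c p\<close>. It holds for the partial
  sums, with a boundary term in closed form, and so it applies also on the circle \<open>\<bar>t\<bar> = 1\<close>, where the
  series diverges.\<close>
lemma gauss_sum_shift:
  assumes "\<And>i. c * p ^ i \<noteq> 1" "\<And>i. p ^ Suc i \<noteq> 1"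
  shows "(1 - c) * (1 - t) * (\<Sum>m<M. gauss_term p c s t m)
       - (1 - s + c * t) * (\<Sum>m<M. gauss_term p (c * p) (s * p) (t * p) m)
       = - (1 - c) * (1 - p ^ M) * gauss_term p c s t M"
proof (induction M)
  case (Suc M)
  have nz: "1 - c * p ^ M \<noteq> 0" "1 - p ^ Suc M \<noteq> 0"
    using assms(1)[of M] assms(2)[of M] by auto
  define u where "u = gauss_term p c s t M"
  have sh: "gauss_term p (c * p) (s * p) (t * p) M = u * (p ^ M * (1 - c) / (1 - c * p ^ M))"
    unfolding u_def by (rule gauss_term_shift[OF assms])
  have split: "A * (S + x) - B * (T + y) = (A * S - B * T) + (A * x - B * y)" for A B S T x y :: complex
    by (simp add: algebra_simps)
  have "(1 - c) * (1 - t) * (\<Sum>m<Suc M. gauss_term p c s t m)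
       - (1 - s + c * t) * (\<Sum>m<Suc M. gauss_term p (c * p) (s * p) (t * p) m)
      = - (1 - c) * (1 - p ^ M) * u
        + ((1 - c) * (1 - t) * u - (1 - s + c * t) * (u * (p ^ M * (1 - c) / (1 - c * p ^ M))))"
    unfolding sum.lessThan_Suc split Suc sh u_def [symmetric] ..
  also have "\<dots> = - (1 - c) * (u * ((t - s * p ^ M + c * p ^ (2 * M)) / (1 - c * p ^ M)))"
    using nz(1) by (simp add: divide_simps power_mult power2_eq_square mult_2 power_add) (simp add: algebra_simps)
  also have "\<dots> = - (1 - c) * (1 - p ^ Suc M) * gauss_term p c s t (Suc M)"
    using nz(2) by (simp add: gauss_term_Suc u_def[symmetric] del: power_Suc)
  finally show ?case .
qed simp

lemma gauss_term_altdef: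
  "gauss_term p c s t m = (\<Prod>i<m. t - s * p ^ i + c * p ^ (2 * i)) / (qpoch p p m * qpoch c p m)"
  by (simp add: gauss_term_def qpoch_def prod_dividef prod.distrib mult_ac)


text \<open>Scaling the three parameters by \<open>z\<close> multiplies the numerator of the \<open>m\<close>-th term by \<open>z\<^sup>m\<close> and keeps
  the denominator away from \<open>0\<close>. The constant depends only on \<open>p\<close> and on the bound \<open>B\<close> for \<open>s\<close>.\<close>
lemma gauss_term_bound:
  assumes "norm p < 1"
  obtains K where "K \<ge> 0" "\<And>c s t z m. norm c \<le> norm p \<Longrightarrow> norm s \<le> B \<Longrightarrow> norm t \<le> 1 \<Longrightarrow> norm z \<le> 1
    \<Longrightarrow> norm (gauss_term p (c * z) (s * z) (t * z) m) \<le> K * norm z ^ m"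
proof -
  obtain k where k: "k > 0" "\<And>c n. norm c \<le> norm p \<Longrightarrow> k \<le> norm (qpoch c p n)"
    using qpoch_lower_bound[OF assms] by blast
  define E where "E = exp ((B + 1) / (1 - norm p))"
  have "norm (gauss_term p (c * z) (s * z) (t * z) m) \<le> E / (k * k) * norm z ^ m"
    if c: "norm c \<le> norm p" and s: "norm s \<le> B" and t: "norm t \<le> 1" and z: "norm z \<le> 1" for c s t z m
  proof -
    define N where "N = (\<Prod>i<m. t - s * p ^ i + c * p ^ (2 * i))"
    have cz: "norm (c * z) \<le> norm p"
      using c z mult_mono[of "norm c" "norm p" "norm z" 1] by (simp add: norm_mult)
    have "norm N \<le> exp ((norm s + 1) / (1 - norm p))"
      unfolding N_def using norm_qpoch_numerator_le[of p t c s m] assms t c by auto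
    also have "\<dots> \<le> E"
      unfolding E_def using s assms by (auto intro!: divide_right_mono)
    finally have N: "norm N \<le> E" .
    have "(\<Prod>i<m. t * z - s * z * p ^ i + c * z * p ^ (2 * i)) = z ^ m * N"
    proof -
      have "(\<Prod>i<m. t * z - s * z * p ^ i + c * z * p ^ (2 * i)) = 
          (\<Prod>i<m. z * (t - s * p ^ i + c * p ^ (2 * i)))"
        by (intro prod.cong) (auto simp: algebra_simps)
      thus ?thesis by (simp add: N_def prod.distrib)
    qed
    hence "norm (gauss_term p (c * z) (s * z) (t * z) m) =
        norm z ^ m * norm N / (norm (qpoch p p m) * norm (qpoch (c * z) p m))"
      by (simp add: gauss_term_altdef norm_divide norm_mult norm_power)
    also have "\<dots> \<le> norm z ^ m * E / (k * k)"
      by (intro frac_le mult_mono mult_pos_pos) (use k cz N in \<open>auto simp: E_def\<close>)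
    finally show ?thesis by (simp add: mult_ac)
  qed
  moreover have "E / (k * k) \<ge> 0" using k(1) by (simp add: E_def)
  ultimately show ?thesis using that by blast
qed

text \<open>A bound for the partial sums that is uniform in \<open>c\<close>, \<open>s\<close> and \<open>t\<close>, including the case \<open>t = - 1\<close> of a
  divergent series. One application of the recurrence leads to an absolutely convergent series with
  ratio \<open>p\<close>; the price is the factor \<open>1 - t\<close>.\<close>
lemma gauss_partial_sums_bound:
  assumes "norm p < 1" "B \<ge> 0"
  obtains K where "K \<ge> 0" "\<And>c s t M. norm c \<le> norm p \<Longrightarrow> norm s \<le> B \<Longrightarrow> norm t \<le> 1
    \<Longrightarrow> norm ((1 - t) * (\<Sum>m<M. gauss_term p c s t m)) \<le> K"
proof -
  obtain K where K0: "K \<ge> 0" and K: "\<And>c s t z m. norm c \<le> norm p \<Longrightarrow> norm s \<le> B \<Longrightarrow> norm t \<le> 1 \<Longrightarrow>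
      norm z \<le> 1 \<Longrightarrow> norm (gauss_term p (c * z) (s * z) (t * z) m) \<le> K * norm z ^ m"
    using gauss_term_bound[OF assms(1), of B] by metis
  define L where "L = ((B + 2) * (K / (1 - norm p)) + 4 * K) / (1 - norm p)"
  have "norm ((1 - t) * (\<Sum>m<M. gauss_term p c s t m)) \<le> L"
    if c: "norm c \<le> norm p" and s: "norm s \<le> B" and t: "norm t \<le> 1" for c s t M
  proof -
    define S where "S = (\<Sum>m<M. gauss_term p c s t m)"
    define S' where "S' = (\<Sum>m<M. gauss_term p (c * p) (s * p) (t * p) m)"
    define u where "u = gauss_term p c s t M"
    have u: "norm u \<le> K"
      using K[OF c s t, of 1 M] by (simp add: u_def)
    have S': "norm S' \<le> K / (1 - norm p)"
    proof -
      have "norm S' \<le> (\<Sum>m<M. K * norm p ^ m)"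
        unfolding S'_def by (intro sum_norm_le K c s t) (use assms in auto)
      also have "\<dots> \<le> (\<Sum>m. K * norm p ^ m)"
        by (intro sum_le_suminf summable_mult summable_geometric) (use assms K0 in auto)
      also have "\<dots> = K / (1 - norm p)"
        using assms by (simp add: suminf_mult suminf_geometric summable_geometric)
      finally show ?thesis .
    qed
    have eq: "(1 - c) * ((1 - t) * S) = (1 - s + c * t) * S' - (1 - c) * (1 - p ^ M) * u"
      using gauss_sum_shift[OF power_neq_1[OF assms(1) c], of t s M]
      unfolding S_def S'_def u_def by (simp add: algebra_simps)
    have c1: "norm c \<le> 1" using c assms by simp
    have w: "norm (1 - s + c * t) \<le> B + 2"
    proof -
      have "norm (1 - s + c * t) \<le> norm (1 :: complex) + norm s + norm (c * t)"
        by (metis add_right_mono norm_triangle_ineq norm_triangle_ineq4 order_trans)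
      also have "norm (c * t) \<le> 1" using c1 t by (simp add: norm_mult mult_le_one)
      finally show ?thesis using s by simp
    qed
    have c2: "norm (1 - c) \<le> 2" using c1 norm_triangle_ineq4[of 1 c] by simp
    have p2: "norm (1 - p ^ M) \<le> 2"
      using norm_triangle_ineq4[of 1 "p ^ M"] power_le_one[of "norm p" M] assms
      by (simp add: norm_power)
    have "(1 - norm p) * norm ((1 - t) * S) \<le> norm (1 - c) * norm ((1 - t) * S)"
      by (intro mult_right_mono norm_one_minus_ge c) auto
    also have "\<dots> = norm ((1 - s + c * t) * S' - (1 - c) * (1 - p ^ M) * u)"
      unfolding norm_mult[symmetric] eq ..
    also have "\<dots> \<le> norm ((1 - s + c * t) * S') + norm ((1 - c) * (1 - p ^ M) * u)"
      by (rule norm_triangle_ineq4)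
    also have "\<dots> \<le> (B + 2) * (K / (1 - norm p)) + 2 * 2 * K"
      unfolding norm_mult
      by (intro add_mono mult_mono w S' c2 p2 u) (use assms K0 in \<open>auto intro!: divide_nonneg_nonneg\<close>)
    finally show ?thesis
      using assms by (simp add: L_def S_def pos_le_divide_eq mult.commute)
  qed
  moreover have "L \<ge> 0" using assms K0 by (simp add: L_def)
  ultimately show ?thesis using that by blast
qed

text \<open>The \<open>q\<close>-Gauss sum. For \<open>t = - 1\<close> the partial sums oscillate between two limits, and the mean of
  consecutive partial sums takes the place of the sum. The value \<open>P\<close> is the product of the
  factors collected by iterating the recurrence \<open>c \<mapsto> c p\<close>.\<close>
theorem q_gauss_averaged:
  assumes p: "norm p < 1" and c: "norm c \<le> norm p" and t: "norm t < 1 \<or> t = - 1"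
    and P: "(\<lambda>n. \<Prod>i<n. (1 - s * p ^ i + c * t * p ^ (2 * i)) / ((1 - c * p ^ i) * (1 - t * p ^ i)))
              \<longlonglongrightarrow> P"
  defines "S \<equiv> \<lambda>M. \<Sum>m<M. gauss_term p c s t m"
  shows "(\<lambda>M. (S M + S (Suc M)) / 2) \<longlonglongrightarrow> P"
proof -
  have t1: "norm t \<le> 1" using t by auto
  obtain K where K0: "K \<ge> 0" and K: "\<And>z m. norm z \<le> 1 \<Longrightarrow>
      norm (gauss_term p (c * z) (s * z) (t * z) m) \<le> K * norm z ^ m"
    using gauss_term_bound[OF p, of "norm s"] c t1 by (metis order_refl)
  define T where "T = (\<lambda>k M. \<Sum>m<M. gauss_term p (c * p ^ k) (s * p ^ k) (t * p ^ k) m)"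
  define h where "h = (\<lambda>k. \<Sum>m. gauss_term p (c * p ^ k) (s * p ^ k) (t * p ^ k) m)"
  define w where "w = (\<lambda>k. 1 - s * p ^ k + c * t * p ^ (2 * k))"
  define d where "d = (\<lambda>k. (1 - c * p ^ k) * (1 - t * p ^ k))"
  note nz = power_neq_1[OF p]
  have pk: "norm (p ^ k) \<le> 1" for k using p by (simp add: norm_power power_le_one)
  have pk1: "norm (p ^ k) < 1" if "k \<ge> 1" for k
    using p that by (simp add: norm_power power_less_one_iff)
  have cpk: "norm (c * p ^ k) \<le> norm p" for k
    using mult_mono[OF c pk[of k]] by (simp add: norm_mult)
  have d_nz: "d k \<noteq> 0" for k
  proof -
    have "t * p ^ k \<noteq> 1"
      using t norm_power_mult_less_1[of p t k] qpoch_minus_one_factor_nonzero[OF p, of k] p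
      by (auto simp: mult.commute)
    thus ?thesis using nz(1)[OF c, of k] by (simp add: d_def)
  qed
  have summ: "summable (\<lambda>m. gauss_term p (c * p ^ k) (s * p ^ k) (t * p ^ k) m)" if "k \<ge> 1" for k
  proof (rule summable_comparison_test')
    show "summable (\<lambda>m. K * norm (p ^ k) ^ m)"
      by (intro summable_mult summable_geometric) (use pk1[OF that] in auto)
  qed (use K[OF pk] in auto)
  have T_lim: "T k \<longlonglongrightarrow> h k" if "k \<ge> 1" for k
    unfolding T_def h_def using summ[OF that] by (rule summable_LIMSEQ)
  have shift: "d k * T k M - w k * T (Suc k) M =
      - (1 - c * p ^ k) * (1 - p ^ M) * gauss_term p (c * p ^ k) (s * p ^ k) (t * p ^ k) M" for k M
    using gauss_sum_shift[OF nz[OF cpk[of k]], of "t * p ^ k" "s * p ^ k" M]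
    by (simp add: d_def w_def T_def mult_ac power_mult power2_eq_square power_mult_distrib)
  have rec: "d k * h k = w k * h (Suc k)" if "k \<ge> 1" for k
  proof -
    have "(\<lambda>M. d k * T k M - w k * T (Suc k) M) \<longlonglongrightarrow> d k * h k - w k * h (Suc k)"
      by (intro tendsto_intros T_lim) (use that in auto)
    moreover have "(\<lambda>M. - (1 - c * p ^ k) * (1 - p ^ M) *
        gauss_term p (c * p ^ k) (s * p ^ k) (t * p ^ k) M) \<longlonglongrightarrow> - (1 - c * p ^ k) * (1 - 0) * 0"
      by (intro tendsto_intros tendsto_power_0 p summable_LIMSEQ_zero summ that)
    ultimately show ?thesis unfolding shift using LIMSEQ_unique by fastforce
  qed
  \<comment> \<open>As \<open>k\<close> grows, only the term of index \<open>0\<close> survives.\<close>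
  have h_lim: "h \<longlonglongrightarrow> 1"
  proof -
    have bound: "norm (h k - 1) \<le> K * norm (p ^ k) / (1 - norm p)" if "k \<ge> 1" for k
    proof -
      define f where "f = (\<lambda>m. gauss_term p (c * p ^ k) (s * p ^ k) (t * p ^ k) (Suc m))"
      have f_le: "norm (f m) \<le> K * norm (p ^ k) * norm p ^ m" for m
      proof -
        have "norm (p ^ k) \<le> norm p"
          unfolding norm_power using power_decreasing[of 1 k "norm p"] p that by simp
        hence "norm (p ^ k) ^ m \<le> norm p ^ m" by (intro power_mono) auto
        hence "K * norm (p ^ k) * norm (p ^ k) ^ m \<le> K * norm (p ^ k) * norm p ^ m"
          using K0 by (intro mult_left_mono) auto
        thus ?thesis using K[OF pk[of k], of "Suc m"] by (simp add: f_def mult.assoc)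
      qed
      have geo: "summable (\<lambda>m. K * norm (p ^ k) * norm p ^ m)"
        using p by (intro summable_mult summable_geometric) auto
      have "h k - 1 = (\<Sum>m. f m)"
        unfolding h_def f_def using suminf_split_head[OF summ[OF that]] by simp
      also have "norm \<dots> \<le> (\<Sum>m. K * norm (p ^ k) * norm p ^ m)"
        by (intro norm_suminf_le f_le geo)
      also have "\<dots> = K * norm (p ^ k) / (1 - norm p)"
        using p by (simp add: suminf_mult suminf_geometric summable_geometric)
      finally show ?thesis .
    qed
    have "(\<lambda>k. K * norm (p ^ k) / (1 - norm p)) \<longlonglongrightarrow> K * norm (0 :: complex) / (1 - norm p)"
      by (intro tendsto_intros tendsto_power_0 p) (use p in auto)
    hence "(\<lambda>k. K * norm (p ^ k) / (1 - norm p)) \<longlonglongrightarrow> 0" by simp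
    moreover have "\<forall>\<^sub>F k in sequentially. norm (h k - 1) \<le> K * norm (p ^ k) / (1 - norm p)"
      using bound by (auto simp: eventually_at_top_linorder)
    ultimately have "(\<lambda>k. h k - 1) \<longlonglongrightarrow> 0" by (rule Lim_null_comparison[rotated])
    thus ?thesis by (simp add: LIM_zero_iff)
  qed
  have prod_eq: "(\<Prod>i<Suc n. w i / d i) * h (Suc n) = w 0 / d 0 * h 1" for n
  proof (induction n)
    case (Suc n)
    have "(w (Suc n) / d (Suc n)) * h (Suc (Suc n)) = h (Suc n)"
      using rec[of "Suc n"] d_nz[of "Suc n"] by (simp add: field_simps)
    moreover have "(\<Prod>i<Suc (Suc n). w i / d i) * h (Suc (Suc n)) =
        (\<Prod>i<Suc n. w i / d i) * ((w (Suc n) / d (Suc n)) * h (Suc (Suc n)))"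
      by (simp only: prod.lessThan_Suc mult.assoc)
    ultimately show ?case using Suc by simp
  qed simp
  have P_eq: "P = w 0 / d 0 * h 1"
  proof -
    have "(\<lambda>n. (\<Prod>i<Suc n. w i / d i) * h (Suc n)) \<longlonglongrightarrow> P * 1"
      using LIMSEQ_Suc[OF P] LIMSEQ_Suc[OF h_lim] unfolding w_def d_def by (intro tendsto_mult) auto
    thus ?thesis unfolding prod_eq using LIMSEQ_unique[OF tendsto_const] by fastforce
  qed
  define u where "u = gauss_term p c s t"
  define \<rho> where "\<rho> = (\<lambda>M. (t - s * p ^ M + c * p ^ (2 * M)) / (1 - c * p ^ M))"
  have \<rho>_lim: "\<rho> \<longlonglongrightarrow> t"
  proof -
    have "\<rho> \<longlonglongrightarrow> (t - s * 0 + c * 0) / (1 - c * 0)"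
      unfolding \<rho>_def by (intro tendsto_intros tendsto_power_0 p) auto
    thus ?thesis by simp
  qed
  have u_Suc: "(1 - p ^ Suc M) * u (Suc M) = u M * \<rho> M" for M
    using nz(2)[OF c, of M] nz(1)[OF c, of M] by (simp add: u_def gauss_term_Suc \<rho>_def del: power_Suc)
  \<comment> \<open>The mean of two consecutive boundary terms vanishes in the limit; for \<open>t = - 1\<close> they cancel each other.\<close>
  have Z: "(\<lambda>M. (1 - p ^ M) * u M + (1 - p ^ Suc M) * u (Suc M)) \<longlonglongrightarrow> 0"
  proof (cases "t = - 1")
    case True
    have "(\<lambda>M. (1 - p ^ M) + \<rho> M) \<longlonglongrightarrow> (1 - 0) + t"
      by (intro tendsto_intros tendsto_power_0 p \<rho>_lim)
    hence 0: "(\<lambda>M. (1 - p ^ M) + \<rho> M) \<longlonglongrightarrow> 0" using True by simp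
    have "norm (u M * ((1 - p ^ M) + \<rho> M)) \<le> norm ((1 - p ^ M) + \<rho> M) * K" for M
      using mult_left_mono[OF K[of 1 M], of "norm ((1 - p ^ M) + \<rho> M)"]
      by (simp add: u_def norm_mult mult.commute)
    hence "(\<lambda>M. u M * ((1 - p ^ M) + \<rho> M)) \<longlonglongrightarrow> 0"
      by (intro tendsto_0_le[OF 0, of _ K] always_eventually allI)
    thus ?thesis unfolding u_Suc by (simp add: algebra_simps)
  next
    case False
    hence t': "norm t < 1" using t by simp
    have "summable u"
    proof -
      have "u (Suc M) = \<rho> M / (1 - p ^ Suc M) * u M" for M
        using u_Suc[of M] nz(2)[OF c, of M] by (simp add: field_simps del: power_Suc)
      moreover have "(\<lambda>M. \<rho> M / (1 - p ^ Suc M)) \<longlonglongrightarrow> t / (1 - 0)"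
        by (intro tendsto_intros \<rho>_lim LIMSEQ_Suc tendsto_power_0 p) auto
      ultimately show ?thesis using t' by (intro summable_ratio_limit[of u _ t]) auto
    qed
    hence u0: "u \<longlonglongrightarrow> 0" by (rule summable_LIMSEQ_zero)
    have "(\<lambda>M. (1 - p ^ M) * u M + (1 - p ^ Suc M) * u (Suc M)) \<longlonglongrightarrow> (1 - 0) * 0 + (1 - 0) * 0"
      by (intro tendsto_intros tendsto_power_0 p u0 LIMSEQ_Suc[OF u0] LIMSEQ_Suc[OF tendsto_power_0(1)[OF p]])
    thus ?thesis by simp
  qed
  have avg: "(S M + S (Suc M)) / 2 = (w 0 * ((T 1 M + T 1 (Suc M)) / 2)
      - (1 - c) / 2 * ((1 - p ^ M) * u M + (1 - p ^ Suc M) * u (Suc M))) / d 0" for M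
  proof -
    have S: "d 0 * S M = w 0 * T 1 M - (1 - c) * ((1 - p ^ M) * u M)" for M
      using shift[of 0 M] by (simp add: S_def T_def u_def algebra_simps)
    have "d 0 * ((S M + S (Suc M)) / 2) = (d 0 * S M + d 0 * S (Suc M)) / 2"
      by (simp add: algebra_simps)
    also have "\<dots> = w 0 * ((T 1 M + T 1 (Suc M)) / 2)
      - (1 - c) / 2 * ((1 - p ^ M) * u M + (1 - p ^ Suc M) * u (Suc M))"
      unfolding S by (simp add: field_simps)
    finally show ?thesis using d_nz[of 0] by (simp add: field_simps)
  qed
  have "(\<lambda>M. (S M + S (Suc M)) / 2) \<longlonglongrightarrow>
      (w 0 * ((h 1 + h 1) / 2) - (1 - c) / 2 * 0) / d 0"
    unfolding avg by (intro tendsto_intros Z T_lim LIMSEQ_Suc[OF T_lim] d_nz) auto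
  thus ?thesis by (simp add: P_eq)
qed

section \<open>Bailey's lemma\<close>

lemma prod_lessThan_add:
  fixes f :: "nat \<Rightarrow> 'a :: comm_monoid_mult"
  shows "(\<Prod>i<m + n. f i) = (\<Prod>i<m. f i) * (\<Prod>i<n. f (m + i))"
  by (induction n) (simp_all add: mult_ac)

lemma sum_triangle_swap:
  fixes g :: "nat \<Rightarrow> nat \<Rightarrow> 'a :: comm_monoid_add"
  shows "(\<Sum>n<N. \<Sum>r\<le>n. g r (n - r)) = (\<Sum>r<N. \<Sum>m<N - r. g r m)"
proof -
  have "(\<Sum>n<N. \<Sum>r\<le>n. g r (n - r)) = (\<Sum>(r, m)\<in>{(r, m). r + m < N}. g r m)"
    by (rule sum.triangle_reindex [symmetric])
  also have "{(r, m). r + m < N} = Sigma {..<N} (\<lambda>r. {..<N - r})"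
    by auto
  also have "(\<Sum>(r, m)\<in>Sigma {..<N} (\<lambda>r. {..<N - r}). g r m) = (\<Sum>r<N. \<Sum>m<N - r. g r m)"
    by (rule sum.Sigma [symmetric]) auto
  finally show ?thesis .
qed

text \<open>Bailey's lemma with \<open>a = p\<^sup>e\<close>: a sum against \<open>\<beta>\<close> turns into a sum against \<open>\<alpha>\<close>. In the classical notation
  \<open>t = a p / (\<rho>\<^sub>1 \<rho>\<^sub>2)\<close> and \<open>s = a p (1 / \<rho>\<^sub>1 + 1 / \<rho>\<^sub>2)\<close>, so that \<open>\<delta> n = (\<rho>\<^sub>1)\<^sub>n (\<rho>\<^sub>2)\<^sub>n t\<^sup>n\<close> and the product of the
  \<open>w i\<close> is \<open>(a p / \<rho>\<^sub>1)\<^sub>r (a p / \<rho>\<^sub>2)\<^sub>r\<close>. Means of consecutive partial sums are used in order to include \<open>t = - 1\<close>.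
  For fixed \<open>r\<close> the sum over \<open>n\<close> is a \<open>q\<close>-Gauss sum with \<open>c = p\<^bsup>2 r + e + 1\<^esup>\<close>; the uniform bound on its partial sums
  justifies the passage to the limit under the sum over \<open>r\<close>.\<close>
theorem bailey_lemma_averaged:
  fixes p s t W :: complex and e :: nat and \<alpha> :: "nat \<Rightarrow> complex"
  assumes p: "norm p < 1" and t: "norm t < 1 \<or> t = - 1"
    and \<alpha>: "summable (\<lambda>r. norm (\<alpha> r))"
  defines "w \<equiv> \<lambda>i. 1 - s * p ^ i + t * p ^ (e + 1 + 2 * i)"
  assumes w: "\<And>i. w i \<noteq> 0" and W: "(\<lambda>n. \<Prod>i<n. w i) \<longlonglongrightarrow> W"
  defines "\<delta> \<equiv> \<lambda>n. \<Prod>i<n. t - s * p ^ i + p ^ (e + 1 + 2 * i)"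
  defines "\<beta> \<equiv> \<lambda>n. \<Sum>r\<le>n. \<alpha> r / (qpoch p p (n - r) * qpoch p p (n + r + e))"
  shows "(\<lambda>N. ((\<Sum>n<N. \<delta> n * \<beta> n) + (\<Sum>n<Suc N. \<delta> n * \<beta> n)) / 2) \<longlonglongrightarrow>
    W / (qpoch_inf p p * qpoch_inf t p) * (\<Sum>r. \<alpha> r * (\<delta> r / (\<Prod>i<r. w i)))"
proof -
  define c where "c = (\<lambda>r. p ^ (2 * r + e) * p)"
  define S where "S = (\<lambda>r M. \<Sum>m<M. gauss_term p (c r) (s * p ^ r) t m)"
  define D where "D = (\<lambda>r. \<delta> r / qpoch p p (2 * r + e))"
  have t1: "norm t \<le> 1" using t by auto
  have t_nz: "p ^ i * t \<noteq> 1" for i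
    using t norm_power_mult_less_1[of p t i] qpoch_minus_one_factor_nonzero[OF p, of i] p by auto
  have pn: "norm (p ^ n) \<le> 1" for n using p by (simp add: norm_power power_le_one)
  have c: "norm (c r) \<le> norm p" for r
    using mult_right_mono[OF pn[of "2 * r + e"], of "norm p"] by (simp add: c_def norm_mult)
  have sp: "norm (s * p ^ r) \<le> norm s" for r
    using mult_left_mono[OF pn[of r], of "norm s"] by (simp add: norm_mult)

  have term_eq: "\<delta> (r + m) * (\<alpha> r / (qpoch p p m * qpoch p p (r + m + r + e))) =
      \<alpha> r * D r * gauss_term p (c r) (s * p ^ r) t m" for r m
  proof -
    have "\<delta> (r + m) = \<delta> r * (\<Prod>i<m. t - s * p ^ r * p ^ i + c r * p ^ (2 * i))"
      unfolding \<delta>_def prod_lessThan_add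
      by (intro arg_cong2[where f = "(*)"] prod.cong) (auto simp: c_def power_add mult_ac)
    moreover have "qpoch p p (r + m + r + e) = qpoch p p (2 * r + e) * qpoch (c r) p m"
      using qpoch_add[of p p "2 * r + e" m] by (simp add: c_def mult_2 add_ac)
    ultimately show ?thesis by (simp add: D_def gauss_term_altdef mult_ac)
  qed
  have swap: "(\<Sum>n<N. \<delta> n * \<beta> n) = (\<Sum>r<N. \<alpha> r * D r * S r (N - r))" for N
  proof -
    have "(\<Sum>n<N. \<delta> n * \<beta> n) = (\<Sum>n<N. \<Sum>r\<le>n. (\<lambda>r m. \<delta> (r + m) *
        (\<alpha> r / (qpoch p p m * qpoch p p (r + m + r + e)))) r (n - r))"
      unfolding \<beta>_def sum_distrib_left by (intro sum.cong) auto
    also have "\<dots> = (\<Sum>r<N. \<Sum>m<N - r. \<alpha> r * D r * gauss_term p (c r) (s * p ^ r) t m)"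
      by (subst sum_triangle_swap) (simp only: term_eq)
    finally show ?thesis by (simp add: S_def sum_distrib_left)
  qed
  \<comment> \<open>\<open>Suc N - r\<close> instead of \<open>Suc (N - r)\<close>: all terms with \<open>r > N\<close> are then \<open>0\<close>.\<close>
  define a where "a = (\<lambda>r N. \<alpha> r * D r * ((S r (N - r) + S r (Suc N - r)) / 2))"
  have avg: "((\<Sum>n<N. \<delta> n * \<beta> n) + (\<Sum>n<Suc N. \<delta> n * \<beta> n)) / 2 = (\<Sum>r. a r N)" for N
  proof -
    have "(\<Sum>r. a r N) = (\<Sum>r<Suc N. a r N)"
      by (rule suminf_finite) (auto simp: a_def S_def)
    also have "\<dots> = ((\<Sum>r<Suc N. \<alpha> r * D r * S r (N - r)) + (\<Sum>r<Suc N. \<alpha> r * D r * S r (Suc N - r))) / 2"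
      by (simp only: a_def sum.distrib[symmetric] sum_divide_distrib distrib_left add_divide_distrib
            times_divide_eq_right)
    also have "(\<Sum>r<Suc N. \<alpha> r * D r * S r (N - r)) = (\<Sum>r<N. \<alpha> r * D r * S r (N - r))"
      by (simp add: S_def)
    finally show ?thesis unfolding swap by simp
  qed

  define Q where "Q = W / (qpoch_inf p p * qpoch_inf t p)"
  have Wr: "(\<Prod>i<r. w i) \<noteq> 0" for r using w by simp
  have a_lim: "a r \<longlonglongrightarrow> Q * (\<alpha> r * (\<delta> r / (\<Prod>i<r. w i)))" for r
  proof -
    define P where "P = W / (\<Prod>i<r. w i) / (qpoch_inf (c r) p * qpoch_inf t p)"
    have c1: "norm (c r) < 1" using c[of r] p by simp
    have lim_P: "(\<lambda>n. \<Prod>i<n. (1 - s * p ^ r * p ^ i + c r * t * p ^ (2 * i)) /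
        ((1 - c r * p ^ i) * (1 - t * p ^ i))) \<longlonglongrightarrow> P"
    proof -
      have "(\<Prod>i<n. (1 - s * p ^ r * p ^ i + c r * t * p ^ (2 * i)) /
          ((1 - c r * p ^ i) * (1 - t * p ^ i))) =
          (\<Prod>i<n + r. w i) / (\<Prod>i<r. w i) / (qpoch (c r) p n * qpoch t p n)" for n
      proof -
        have "(\<Prod>i<n + r. w i) / (\<Prod>i<r. w i) = (\<Prod>i<n. w (r + i))"
          using Wr[of r] prod_lessThan_add[of w r n] by (simp add: add.commute)
        also have "\<dots> = (\<Prod>i<n. 1 - s * p ^ r * p ^ i + c r * t * p ^ (2 * i))"
          by (intro prod.cong) (auto simp: w_def c_def power_add mult_ac)
        finally show ?thesis
          by (simp add: qpoch_def prod_dividef prod.distrib mult.commute)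
      qed
      moreover have "(\<lambda>n. (\<Prod>i<n + r. w i) / (\<Prod>i<r. w i) / (qpoch (c r) p n * qpoch t p n)) \<longlonglongrightarrow> P"
        unfolding P_def
        using qpoch_tendsto'(2)[OF p c1] qpoch_inf_nonzero[OF p t_nz]
        by (intro tendsto_divide[OF tendsto_divide[OF LIMSEQ_ignore_initial_segment[OF W] tendsto_const Wr]
              tendsto_mult[OF qpoch_tendsto'(1)[OF p c1] qpoch_tendsto[OF p t_nz]]]) simp
      ultimately show ?thesis by simp
    qed
    have cinf: "qpoch_inf p p = qpoch p p (2 * r + e) * qpoch_inf (c r) p"
    proof -
      have "(\<lambda>n. qpoch p p (n + (2 * r + e))) \<longlonglongrightarrow> qpoch_inf p p"
        by (intro LIMSEQ_ignore_initial_segment qpoch_tendsto' p)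
      moreover have "(\<lambda>n. qpoch p p (n + (2 * r + e))) = (\<lambda>n. qpoch p p (2 * r + e) * qpoch (c r) p n)"
        unfolding c_def by (subst add.commute) (simp only: qpoch_add)
      moreover have "(\<lambda>n. qpoch p p (2 * r + e) * qpoch (c r) p n) \<longlonglongrightarrow>
          qpoch p p (2 * r + e) * qpoch_inf (c r) p"
        by (intro tendsto_intros qpoch_tendsto' p c1)
      ultimately show ?thesis using LIMSEQ_unique by metis
    qed
    have "(\<lambda>N. a r (N + r)) \<longlonglongrightarrow> \<alpha> r * D r * P"
    proof -
      have "(\<lambda>M. (S r M + S r (Suc M)) / 2) \<longlonglongrightarrow> P"
        unfolding S_def by (rule q_gauss_averaged[OF p c t lim_P])
      thus ?thesis unfolding a_def by (intro tendsto_intros) (simp add: Suc_diff_le)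
    qed
    hence "a r \<longlonglongrightarrow> \<alpha> r * D r * P" by (rule LIMSEQ_offset)
    moreover have "\<alpha> r * D r * P = Q * (\<alpha> r * (\<delta> r / (\<Prod>i<r. w i)))"
      by (simp add: D_def P_def Q_def cinf mult_ac)
    ultimately show ?thesis by simp
  qed

  obtain K where K0: "K \<ge> 0" and K: "\<And>c s' t M. norm c \<le> norm p \<Longrightarrow> norm s' \<le> norm s \<Longrightarrow> norm t \<le> 1
    \<Longrightarrow> norm ((1 - t) * (\<Sum>m<M. gauss_term p c s' t m)) \<le> K"
    using gauss_partial_sums_bound[OF p norm_ge_zero, of s] by metis
  obtain k where k: "k > 0" "\<And>c n. norm c \<le> norm p \<Longrightarrow> k \<le> norm (qpoch c p n)"
    using qpoch_lower_bound[OF p] by metis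
  define E where "E = exp ((norm s + 1) / (1 - norm p))"
  have D_le: "norm (D r) \<le> E / k" for r
  proof -
    have "\<delta> r = (\<Prod>i<r. t - s * p ^ i + p ^ (e + 1) * p ^ (2 * i))"
      unfolding \<delta>_def by (simp add: power_add mult_ac)
    also have "norm \<dots> \<le> E"
      unfolding E_def by (intro norm_qpoch_numerator_le p t1 pn)
    finally show ?thesis
      unfolding D_def norm_divide by (intro frac_le k) (auto simp: E_def)
  qed
  have S_le: "norm (S r M) \<le> K / norm (1 - t)" for r M
  proof -
    have "1 - t \<noteq> 0" using t by auto
    thus ?thesis
      using K[OF c[of r] sp[of r] t1, of M] by (simp add: S_def norm_mult pos_le_divide_eq mult.commute)
  qed
  define b where "b = (\<lambda>r. Q * (\<alpha> r * (\<delta> r / (\<Prod>i<r. w i))))"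
  have "summable (\<lambda>r. norm (b r)) \<and> (\<lambda>N. \<Sum>r. a r N) \<longlonglongrightarrow> (\<Sum>r. b r)"
  proof (rule tannerys_theorem[THEN conjunct2])
    show "\<forall>\<^sub>F (r, N) in at_top \<times>\<^sub>F sequentially. norm (a r N) \<le> norm (\<alpha> r) * (E / k * (K / norm (1 - t)))"
    proof (intro always_eventually allI, clarify)
      fix r N
      have "norm (S r (N - r) + S r (Suc N - r)) \<le> K / norm (1 - t) + K / norm (1 - t)"
        by (intro order.trans[OF norm_triangle_ineq] add_mono S_le)
      hence "norm ((S r (N - r) + S r (Suc N - r)) / 2) \<le> K / norm (1 - t)"
        by (simp add: norm_divide mult.commute)
      thus "norm (a r N) \<le> norm (\<alpha> r) * (E / k * (K / norm (1 - t)))"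
        unfolding a_def norm_mult mult.assoc
        by (intro mult_left_mono mult_mono D_le) (use k in \<open>auto simp: E_def\<close>)
    qed
    show "summable (\<lambda>r. norm (\<alpha> r) * (E / k * (K / norm (1 - t))))"
      by (intro summable_mult2 \<alpha>)
  qed (use a_lim in \<open>auto simp: b_def\<close>)
  moreover have "(\<Sum>r. b r) = Q * (\<Sum>r. \<alpha> r * (\<delta> r / (\<Prod>i<r. w i)))" if "summable (\<lambda>r. norm (b r))"
  proof (cases "Q = 0")
    case False
    from summable_norm_cancel[OF that] have "summable (\<lambda>r. \<alpha> r * (\<delta> r / (\<Prod>i<r. w i)))"
      unfolding b_def using False by (subst (asm) summable_cmult_iff) auto
    thus ?thesis unfolding b_def by (rule suminf_mult)
  qed (simp add: b_def)
  ultimately show ?thesis unfolding avg Q_def by simp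
qed

section \<open>Two Bailey pairs\<close>

text \<open>The truncated subtraction is harmless: for \<open>r = 0\<close> both sides are \<open>0\<close>.\<close>
lemma triangle_pred: "triangle (r - 1) + r = triangle r"
  by (cases r) auto

text \<open>The unit Bailey pair for \<open>a = 1\<close>, in the form of a closed expression for the partial sums over \<open>r\<close>. For
  \<open>R = n\<close> the right-hand side vanishes.\<close>
lemma unit_pair_sum_0:
  assumes q: "norm q < 1" and "0 < n" "R \<le> n"
  shows "(\<Sum>r\<le>R. (if r = 0 then 1 else (- 1) ^ r * q ^ triangle (r - 1) * (1 + q ^ r))
            / (qpoch q q (n - r) * qpoch q q (n + r)))
    = (- 1) ^ R * q ^ triangle R * (1 - q ^ (n - R)) /
        ((1 - q ^ n) * (qpoch q q (n - R) * qpoch q q (n + R)))"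
  using assms(3)
proof (induction R)
  case 0
  have "q ^ n \<noteq> 1"
    using power_neq_1(2)[OF q order_refl, of "n - 1"] assms(2) by simp
  thus ?case using assms by simp
next
  case (Suc R)
  then obtain k where k: "n = Suc (R + k)" using less_natE[of R n] by (auto simp: Suc_le_eq)
  have nk: "n - R = Suc k" "n - Suc R = k" "n + Suc R = Suc (n + R)" using k by auto
  have nz: "1 - q ^ n \<noteq> 0" "qpoch q q k \<noteq> 0" "qpoch q q (n + R) \<noteq> 0" "1 - q ^ Suc k \<noteq> 0" "1 - q ^ Suc (n + R) \<noteq> 0"
    using power_neq_1(2)[OF q order_refl, of "n - 1"] power_neq_1(2)[OF q order_refl, of k]
      power_neq_1(2)[OF q order_refl, of "n + R"] qpoch_nonzero[of q q] q k by auto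
  define A where "A = qpoch q q k"
  define B where "B = qpoch q q (n + R)"
  define x where "x = q ^ R"
  define y where "y = q ^ k"
  have qs: "q ^ n = q * x * y" "q ^ Suc (n + R) = q * q * x * x * y" "q ^ Suc k = q * y" "q ^ Suc R = q * x"
    by (simp_all add: k x_def y_def power_add)
  have IH: "(\<Sum>r\<le>R. (if r = 0 then 1 else (- 1) ^ r * q ^ triangle (r - 1) * (1 + q ^ r))
            / (qpoch q q (n - r) * qpoch q q (n + r))) =
      (- 1) ^ R * q ^ triangle R * (1 - q * y) / ((1 - q * x * y) * ((A * (1 - q * y)) * B))"
    using Suc.IH Suc.prems by (simp only: nk qpoch_base_Suc qs A_def B_def)
  have "(- 1) ^ R * q ^ triangle R * (1 - q * y) / ((1 - q * x * y) * ((A * (1 - q * y)) * B))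
      + (- 1) ^ Suc R * q ^ triangle R * (1 + q * x) / (A * (B * (1 - q * q * x * x * y)))
      = (- 1) ^ Suc R * (q ^ triangle R * (q * x)) * (1 - y) / ((1 - q * x * y) * (A * (B * (1 - q * q * x * x * y))))"
    using nz unfolding qs A_def[symmetric] B_def[symmetric]
    by (simp add: divide_simps) (simp add: algebra_simps)
  thus ?case
    unfolding sum.atMost_Suc IH nk
    by (simp only: qpoch_base_Suc nk qs A_def[symmetric] B_def[symmetric] triangle_Suc power_add[of q "triangle R" "Suc R"] y_def[symmetric]
          nat.distinct if_False diff_Suc_1)
qed

text \<open>The same for \<open>a = q\<close>.\<close>
lemma unit_pair_sum_1:
  assumes q: "norm q < 1" and "0 < n" "R \<le> n"
  shows "(\<Sum>r\<le>R. (- 1) ^ r * q ^ triangle (r - 1) * (1 - q ^ (2 * r + 1))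
            / (qpoch q q (n - r) * qpoch q q (n + r + 1)))
    = (- 1) ^ R * q ^ triangle R * (1 - q ^ (n - R)) * (1 - q ^ Suc R) /
        ((1 - q ^ n) * (qpoch q q (n - R) * qpoch q q (n + R + 1)))"
  using assms(3)
proof (induction R)
  case 0
  have "q ^ n \<noteq> 1"
    using power_neq_1(2)[OF q order_refl, of "n - 1"] assms(2) by simp
  thus ?case using assms by simp
next
  case (Suc R)
  then obtain k where k: "n = Suc (R + k)" using less_natE[of R n] by (auto simp: Suc_le_eq)
  have nk: "n - R = Suc k" "n - Suc R = k" "n + Suc R + 1 = Suc (n + R + 1)" using k by auto
  have nz: "1 - q ^ n \<noteq> 0" "qpoch q q k \<noteq> 0" "qpoch q q (n + R + 1) \<noteq> 0" "1 - q ^ Suc k \<noteq> 0" "1 - q ^ Suc (n + R + 1) \<noteq> 0"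
    using power_neq_1(2)[OF q order_refl, of "n - 1"] power_neq_1(2)[OF q order_refl, of k]
      power_neq_1(2)[OF q order_refl, of "n + R + 1"] qpoch_nonzero[of q q] q k by auto
  define A where "A = qpoch q q k"
  define B where "B = qpoch q q (n + R + 1)"
  define x where "x = q ^ R"
  define y where "y = q ^ k"
  have qs: "q ^ n = q * x * y" "q ^ Suc (n + R + 1) = q * q * q * x * x * y" "q ^ Suc k = q * y" "q ^ Suc R = q * x"
      "q ^ Suc (Suc R) = q * q * x" "q ^ (2 * Suc R + 1) = q * q * q * x * x"
    by (simp_all add: k x_def y_def power_add mult_2)
  have IH: "(\<Sum>r\<le>R. (- 1) ^ r * q ^ triangle (r - 1) * (1 - q ^ (2 * r + 1))
            / (qpoch q q (n - r) * qpoch q q (n + r + 1))) =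
      (- 1) ^ R * q ^ triangle R * (1 - q * y) * (1 - q * x) / ((1 - q * x * y) * ((A * (1 - q * y)) * B))"
    using Suc.IH Suc.prems by (simp only: nk qpoch_base_Suc qs A_def B_def)
  have "(- 1) ^ R * q ^ triangle R * (1 - q * y) * (1 - q * x) / ((1 - q * x * y) * ((A * (1 - q * y)) * B))
      + (- 1) ^ Suc R * q ^ triangle R * (1 - q * q * q * x * x) / (A * (B * (1 - q * q * q * x * x * y)))
      = (- 1) ^ Suc R * (q ^ triangle R * (q * x)) * (1 - y) * (1 - q * q * x) /
        ((1 - q * x * y) * (A * (B * (1 - q * q * q * x * x * y))))"
    using nz unfolding qs A_def[symmetric] B_def[symmetric]
    by (simp add: divide_simps) (simp add: algebra_simps)
  thus ?case
    unfolding sum.atMost_Suc IH nk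
    by (simp only: qpoch_base_Suc nk qs A_def[symmetric] B_def[symmetric] triangle_Suc power_add[of q "triangle R" "Suc R"] y_def[symmetric]
          diff_Suc_1)
qed

lemma eq_inverse_mult:
  fixes S Z P :: complex
  assumes "Z * S = 1 / P" "Z \<noteq> 0"
  shows "S = 1 / (P * Z)"
  by (metis assms divide_divide_eq_left nonzero_mult_div_cancel_left)

text \<open>A Bailey pair for \<open>a = 1\<close>. With \<open>X = x + 1 / x\<close> it is the partial fraction expansion of \<open>1 / ((x q)\<^sub>n (q / x)\<^sub>n)\<close>.
  The recurrence in \<open>n\<close> rests on the identity
  \<open>1 - X Q + Q\<^sup>2 = (1 - Q q\<^bsup>- r\<^esup>) (1 - Q q\<^sup>r) + Q q\<^bsup>- r\<^esup> (1 - X q\<^sup>r + q\<^bsup>2 r\<^esup>)\<close> for \<open>Q = q\<^bsup>n + 1\<^esup>\<close>: the first summand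
  lowers \<open>n\<close>, and the second cancels the denominator of \<open>\<alpha> r\<close> and leaves the unit pair, whose sum is \<open>0\<close>.\<close>
lemma bailey_pair_0:
  assumes q: "norm q < 1" and X: "\<And>r. 1 - X * q ^ Suc r + q ^ (2 * Suc r) \<noteq> 0"
  defines "\<alpha> \<equiv> \<lambda>r. if r = 0 then 1 else
     (2 - X) * ((- 1) ^ r * q ^ triangle r * (1 + q ^ r)) / (1 - X * q ^ r + q ^ (2 * r))"
  shows "(\<Sum>r\<le>n. \<alpha> r / (qpoch q q (n - r) * qpoch q q (n + r))) =
    1 / (\<Prod>i<n. 1 - X * q ^ Suc i + q ^ (2 * Suc i))"
proof (induction n)
  case 0
  show ?case by (simp add: \<alpha>_def)
next
  case (Suc n)
  define \<epsilon> where "\<epsilon> = (\<lambda>r. if r = 0 then 1 else (- 1) ^ r * q ^ triangle (r - 1) * (1 + q ^ r))"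
  define Q where "Q = q ^ Suc n"
  define D where "D = (\<lambda>r. qpoch q q (Suc n - r) * qpoch q q (Suc n + r))"
  note nz = power_neq_1(2)[OF q order_refl]
  have key: "(1 - X * Q + q ^ (2 * Suc n)) * (\<alpha> r / D r) =
      (1 - q ^ (Suc n - r)) * (1 - q ^ (Suc n + r)) * (\<alpha> r / D r) + (2 - X) * Q * (\<epsilon> r / D r)"
    if "r \<le> Suc n" for r
  proof -
    define z where "z = q ^ (Suc n - r)"
    define x where "x = q ^ r"
    have zx: "Q = z * x" "q ^ (Suc n + r) = z * x * x" "q ^ (2 * Suc n) = z * x * z * x" "q ^ (2 * r) = x * x"
      using that by (simp_all add: Q_def z_def x_def flip: power_add power_Suc mult_2)
    have "z * (1 - X * x + x * x) * \<alpha> r = (2 - X) * Q * \<epsilon> r"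
    proof (cases "r = 0")
      case True
      thus ?thesis by (simp add: \<alpha>_def \<epsilon>_def x_def z_def Q_def)
    next
      case False
      have "q ^ triangle r = q ^ triangle (r - 1) * x"
        unfolding x_def power_add[symmetric] triangle_pred ..
      moreover have "1 - X * x + x * x \<noteq> 0"
        using X[of "r - 1"] False by (simp add: x_def power_mult power2_eq_square mult_2 power_add del: power_Suc)
      ultimately show ?thesis
        using False zx by (simp add: \<alpha>_def \<epsilon>_def x_def[symmetric])
    qed
    moreover have "1 - X * Q + q ^ (2 * Suc n) = (1 - z) * (1 - q ^ (Suc n + r)) + z * (1 - X * x + x * x)"
      unfolding zx by (simp add: algebra_simps)
    ultimately show ?thesis
      unfolding z_def[symmetric] by (simp add: distrib_right mult.assoc[symmetric] add_divide_distrib)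
  qed
  have "(1 - X * Q + q ^ (2 * Suc n)) * (\<Sum>r\<le>Suc n. \<alpha> r / D r) =
      (\<Sum>r\<le>Suc n. (1 - q ^ (Suc n - r)) * (1 - q ^ (Suc n + r)) * (\<alpha> r / D r))
      + (2 - X) * Q * (\<Sum>r\<le>Suc n. \<epsilon> r / D r)"
    unfolding sum_distrib_left sum.distrib[symmetric] by (intro sum.cong refl key) auto
  also have "(\<Sum>r\<le>Suc n. \<epsilon> r / D r) = 0"
    using unit_pair_sum_0[OF q, of "Suc n" "Suc n"] by (simp add: \<epsilon>_def D_def)
  also have "(\<Sum>r\<le>Suc n. (1 - q ^ (Suc n - r)) * (1 - q ^ (Suc n + r)) * (\<alpha> r / D r)) =
      (\<Sum>r\<le>n. (1 - q ^ (Suc n - r)) * (1 - q ^ (Suc n + r)) * (\<alpha> r / D r))"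
    by simp
  also have "\<dots> = (\<Sum>r\<le>n. \<alpha> r / (qpoch q q (n - r) * qpoch q q (n + r)))"
  proof (intro sum.cong refl)
    fix r assume "r \<in> {..n}"
    hence "D r = (1 - q ^ (Suc n - r)) * (1 - q ^ (Suc n + r)) * (qpoch q q (n - r) * qpoch q q (n + r))"
      by (simp add: D_def Suc_diff_le qpoch_base_Suc mult_ac del: power_Suc)
    moreover have "1 - q ^ (Suc n - r) \<noteq> 0" "1 - q ^ (Suc n + r) \<noteq> 0"
      using nz[of "n - r"] nz[of "n + r"] \<open>r \<in> {..n}\<close> by (simp_all add: Suc_diff_le)
    ultimately show "(1 - q ^ (Suc n - r)) * (1 - q ^ (Suc n + r)) * (\<alpha> r / D r) =
        \<alpha> r / (qpoch q q (n - r) * qpoch q q (n + r))" by simp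
  qed
  finally have "(1 - X * Q + q ^ (2 * Suc n)) * (\<Sum>r\<le>Suc n. \<alpha> r / D r) =
      1 / (\<Prod>i<n. 1 - X * q ^ Suc i + q ^ (2 * Suc i))"
    unfolding Suc by simp
  thus ?case
    unfolding D_def Q_def prod.lessThan_Suc by (rule eq_inverse_mult[OF _ X])
qed

text \<open>The analogous Bailey pair for \<open>a = q\<close>. With \<open>X = x + q / x\<close> it is the partial fraction expansion of
  \<open>1 / ((x)\<^sub>n\<^sub>+\<^sub>1 (q / x)\<^sub>n\<^sub>+\<^sub>1)\<close>.\<close>
lemma bailey_pair_1:
  assumes q: "norm q < 1" and X: "\<And>r. 1 - X * q ^ r + q ^ (2 * r + 1) \<noteq> 0"
  defines "\<alpha> \<equiv> \<lambda>r. (- 1) ^ r * q ^ triangle r * (1 - q ^ (2 * r + 1)) / (1 - X * q ^ r + q ^ (2 * r + 1))"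
  shows "(\<Sum>r\<le>n. \<alpha> r / (qpoch q q (n - r) * qpoch q q (n + r + 1))) =
    1 / (\<Prod>i\<le>n. 1 - X * q ^ i + q ^ (2 * i + 1))"
proof (induction n)
  case 0
  show ?case using X[of 0] power_neq_1(2)[OF q order_refl, of 0] by (simp add: \<alpha>_def qpoch_Suc)
next
  case (Suc n)
  define \<epsilon> where "\<epsilon> = (\<lambda>r. (- 1) ^ r * q ^ triangle (r - 1) * (1 - q ^ (2 * r + 1)))"
  define Q where "Q = q ^ Suc n"
  define D where "D = (\<lambda>r. qpoch q q (Suc n - r) * qpoch q q (Suc n + r + 1))"
  note nz = power_neq_1(2)[OF q order_refl]
  have key: "(1 - X * Q + q ^ (2 * Suc n + 1)) * (\<alpha> r / D r) =
      (1 - q ^ (Suc n - r)) * (1 - q ^ (Suc n + r + 1)) * (\<alpha> r / D r) + Q * (\<epsilon> r / D r)"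
    if "r \<le> Suc n" for r
  proof -
    define z where "z = q ^ (Suc n - r)"
    define x where "x = q ^ r"
    have zx: "Q = z * x" "q ^ (Suc n + r + 1) = q * (z * x * x)" "q ^ (2 * Suc n + 1) = q * (z * x * z * x)"
        "q ^ (2 * r + 1) = q * (x * x)"
      using that by (simp_all add: Q_def z_def x_def flip: power_add power_Suc mult_2)
    have "q ^ triangle r = q ^ triangle (r - 1) * x"
      unfolding x_def power_add[symmetric] triangle_pred ..
    moreover have "1 - X * x + q * (x * x) \<noteq> 0"
      using X[of r] unfolding zx by (simp add: x_def)
    ultimately have "z * (1 - X * x + q * (x * x)) * \<alpha> r = Q * \<epsilon> r"
      unfolding \<alpha>_def \<epsilon>_def zx x_def[symmetric] by simp
    moreover have "1 - X * Q + q ^ (2 * Suc n + 1) =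
        (1 - z) * (1 - q ^ (Suc n + r + 1)) + z * (1 - X * x + q * (x * x))"
      unfolding zx by (simp add: algebra_simps)
    ultimately show ?thesis
      unfolding z_def[symmetric] by (simp add: distrib_right mult.assoc[symmetric] add_divide_distrib)
  qed
  have "(1 - X * Q + q ^ (2 * Suc n + 1)) * (\<Sum>r\<le>Suc n. \<alpha> r / D r) =
      (\<Sum>r\<le>Suc n. (1 - q ^ (Suc n - r)) * (1 - q ^ (Suc n + r + 1)) * (\<alpha> r / D r))
      + Q * (\<Sum>r\<le>Suc n. \<epsilon> r / D r)"
    unfolding sum_distrib_left sum.distrib[symmetric] by (intro sum.cong refl key) auto
  also have "(\<Sum>r\<le>Suc n. \<epsilon> r / D r) = 0"
    using unit_pair_sum_1[OF q, of "Suc n" "Suc n"] by (simp add: \<epsilon>_def D_def)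
  also have "(\<Sum>r\<le>Suc n. (1 - q ^ (Suc n - r)) * (1 - q ^ (Suc n + r + 1)) * (\<alpha> r / D r)) =
      (\<Sum>r\<le>n. (1 - q ^ (Suc n - r)) * (1 - q ^ (Suc n + r + 1)) * (\<alpha> r / D r))"
    by simp
  also have "\<dots> = (\<Sum>r\<le>n. \<alpha> r / (qpoch q q (n - r) * qpoch q q (n + r + 1)))"
  proof (intro sum.cong refl)
    fix r assume "r \<in> {..n}"
    hence "D r = (1 - q ^ (Suc n - r)) * (1 - q ^ (Suc n + r + 1)) * (qpoch q q (n - r) * qpoch q q (n + r + 1))"
      by (simp add: D_def Suc_diff_le qpoch_base_Suc mult_ac del: power_Suc)
    moreover have "1 - q ^ (Suc n - r) \<noteq> 0" "1 - q ^ (Suc n + r + 1) \<noteq> 0"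
      using nz[of "n - r"] nz[of "n + r + 1"] \<open>r \<in> {..n}\<close> by (simp_all add: Suc_diff_le)
    ultimately show "(1 - q ^ (Suc n - r)) * (1 - q ^ (Suc n + r + 1)) * (\<alpha> r / D r) =
        \<alpha> r / (qpoch q q (n - r) * qpoch q q (n + r + 1))" by simp
  qed
  finally have "(1 - X * Q + q ^ (2 * Suc n + 1)) * (\<Sum>r\<le>Suc n. \<alpha> r / D r) =
      1 / (\<Prod>i\<le>n. 1 - X * q ^ i + q ^ (2 * i + 1))"
    unfolding Suc by simp
  thus ?case
    unfolding D_def Q_def prod.atMost_Suc by (rule eq_inverse_mult[OF _ X])
qed

section \<open>Fine's transformation\<close>

lemma summable_fine_series:
  fixes a b p t :: complex
  assumes p: "norm p < 1" and b: "norm b \<le> 1" and t: "norm t < 1"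
  shows "summable (\<lambda>n. qpoch (a * p) p n / qpoch (b * p) p n * t ^ n)"
proof (rule summable_ratio_limit)
  show "qpoch (a * p) p (Suc n) / qpoch (b * p) p (Suc n) * t ^ Suc n =
      (1 - p ^ n * (a * p)) / (1 - p ^ n * (b * p)) * t *
      (qpoch (a * p) p n / qpoch (b * p) p n * t ^ n)" for n
    by (simp add: qpoch_Suc mult_ac)
  have "(\<lambda>n. (1 - p ^ n * (a * p)) / (1 - p ^ n * (b * p)) * t) \<longlonglongrightarrow>
      (1 - 0 * (a * p)) / (1 - 0 * (b * p)) * t"
    by (intro tendsto_intros tendsto_power_0 p) auto
  thus "(\<lambda>n. (1 - p ^ n * (a * p)) / (1 - p ^ n * (b * p)) * t) \<longlonglongrightarrow> t" by simp
qed (fact t)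

text \<open>A transformation of Fine. The series \<open>F k\<close> with parameters \<open>b p\<^sup>k\<close> and \<open>t p\<^sup>k\<close> satisfies
  \<open>(1 - t p\<^sup>k) F k = 1 + \<rho> k (1 - t p\<^bsup>k + 1\<^esup>) F (k + 1)\<close>, which is seen by multiplying out the left-hand side and
  comparing coefficients. Iteration gives the series on the left, the remainder tending to \<open>0\<close>.\<close>
theorem fine_transformation:
  fixes a b p t :: complex
  assumes p: "norm p < 1" and b: "norm b \<le> 1" and t: "norm t < 1"
  shows "(\<lambda>n. \<Prod>i<n. (b * p ^ i - a) * t * p ^ Suc i / ((1 - b * p ^ Suc i) * (1 - t * p ^ Suc i)))
    sums ((1 - t) * (\<Sum>n. qpoch (a * p) p n / qpoch (b * p) p n * t ^ n))"
proof -
  define f where "f = (\<lambda>k n. qpoch (a * p) p n / qpoch (b * p ^ Suc k) p n * (t * p ^ k) ^ n)"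
  define F where "F = (\<lambda>k. \<Sum>n. f k n)"
  obtain \<kappa> where \<kappa>: "\<kappa> > 0" "\<And>c n. norm c \<le> norm p \<Longrightarrow> \<kappa> \<le> norm (qpoch c p n)"
    using qpoch_lower_bound[OF p] by metis
  define E where "E = exp ((norm (a * p) + 1) / (1 - norm p))"
  have pk: "norm (p ^ k) \<le> 1" for k using p by (simp add: norm_power power_le_one)
  have bp: "norm (b * p ^ Suc k) \<le> norm p" for k
  proof -
    have "norm b * (norm p * norm (p ^ k)) \<le> 1 * (norm p * 1)"
      by (intro mult_mono b pk) auto
    thus ?thesis by (simp add: norm_mult)
  qed
  have tp: "norm (t * p ^ k) \<le> norm t" for k
    using mult_left_mono[OF pk[of k], of "norm t"] by (simp add: norm_mult)
  have nz: "1 - b * p ^ Suc k \<noteq> 0" "1 - t * p ^ k \<noteq> 0" for k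
    using bp[of k] tp[of k] p t by auto
  have numer: "norm (qpoch (a * p) p n) \<le> E" for n
    unfolding E_def by (rule norm_qpoch_le[OF p])
  have E0: "E \<ge> 0" by (simp add: E_def)
  have f_le: "norm (f k n) \<le> E / \<kappa> * norm t ^ n" for k n
    unfolding f_def norm_mult[of "_ / _"] norm_divide norm_power
    by (intro mult_mono frac_le power_mono \<kappa> bp numer tp) (use \<kappa> E0 in auto)
  have geo: "summable (\<lambda>n. E / \<kappa> * norm t ^ n)"
    using t by (intro summable_mult summable_geometric) auto
  have f_summable: "summable (f k)" for k
    by (rule summable_comparison_test'[OF geo]) (use f_le in auto)
  have F_le: "norm (F k) \<le> E / \<kappa> / (1 - norm t)" for k
  proof -
    have "norm (F k) \<le> (\<Sum>n. E / \<kappa> * norm t ^ n)"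
      unfolding F_def by (intro norm_suminf_le f_le geo)
    also have "\<dots> = E / \<kappa> * (\<Sum>n. norm t ^ n)"
      by (rule suminf_mult) (use t in \<open>simp add: summable_geometric\<close>)
    finally show ?thesis using t by (simp add: suminf_geometric)
  qed
  have step: "(1 - t * p ^ k) * F k = 1 + (b * p ^ k - a) * t * p ^ Suc k / (1 - b * p ^ Suc k) * F (Suc k)" for k
  proof -
    define T where "T = t * p ^ k"
    define c where "c = b * p ^ Suc k"
    have f_eq: "f k n = qpoch (a * p) p n / qpoch c p n * T ^ n" for n
      by (simp only: f_def T_def c_def)
    have f_eq': "f (Suc k) n = qpoch (a * p) p n / qpoch (c * p) p n * (T * p) ^ n" for n
      by (simp add: f_def T_def c_def mult_ac)
    have diff: "f k (Suc n) - T * f k n = (b * p ^ k - a) * t * p ^ Suc k / (1 - c) * f (Suc k) n" for n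
    proof -
      have c: "qpoch c p n \<noteq> 0" "1 - p ^ n * c \<noteq> 0"
        using \<kappa>(2)[OF bp[of k], of n] \<kappa>(1) nz(1)[of "k + n"] by (auto simp: c_def power_add mult_ac)
      have cc: "qpoch c p n * (1 - p ^ n * c) = (1 - c) * qpoch (c * p) p n"
        unfolding qpoch_Suc[symmetric]
        using qpoch_add[of c p 1 n] by (simp add: qpoch_Suc[of c p 0] mult.commute)
      have "f k (Suc n) - T * f k n = T ^ Suc n * qpoch (a * p) p n *
          ((1 - p ^ n * (a * p)) - (1 - p ^ n * c)) / (qpoch c p n * (1 - p ^ n * c))"
        unfolding f_eq qpoch_Suc power_Suc using c by (simp add: divide_simps) (simp add: algebra_simps)
      also have "\<dots> = T ^ Suc n * qpoch (a * p) p n * (p ^ Suc n * (b * p ^ k - a)) / ((1 - c) * qpoch (c * p) p n)"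
        unfolding cc by (simp add: c_def algebra_simps)
      also have "\<dots> = (b * p ^ k - a) * t * p ^ Suc k / (1 - c) * f (Suc k) n"
        unfolding f_eq' by (simp add: T_def power_mult_distrib mult_ac)
      finally show ?thesis .
    qed
    have "F k = 1 + (\<Sum>n. f k (Suc n))"
      using suminf_split_head[OF f_summable[of k]] by (simp add: F_def f_def)
    moreover have "T * F k = (\<Sum>n. T * f k n)"
      unfolding F_def by (rule suminf_mult[OF f_summable, symmetric])
    ultimately have "(1 - T) * F k = 1 + (\<Sum>n. f k (Suc n)) - (\<Sum>n. T * f k n)"
      by (simp add: algebra_simps)
    also have "1 + (\<Sum>n. f k (Suc n)) - (\<Sum>n. T * f k n) = 1 + (\<Sum>n. f k (Suc n) - T * f k n)"
    proof -
      have "summable (\<lambda>n. f k (Suc n))" using f_summable[of k] by (simp add: summable_Suc_iff)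
      from suminf_diff[OF this summable_mult[OF f_summable[of k], of T]] show ?thesis by simp
    qed
    also have "\<dots> = 1 + (b * p ^ k - a) * t * p ^ Suc k / (1 - c) * F (Suc k)"
      unfolding diff F_def by (subst suminf_mult[OF f_summable]) simp
    finally show ?thesis by (simp add: T_def c_def)
  qed
  define G where "G = (\<lambda>k. (1 - t * p ^ k) * F k)"
  define \<rho> where "\<rho> = (\<lambda>i. (b * p ^ i - a) * t * p ^ Suc i / ((1 - b * p ^ Suc i) * (1 - t * p ^ Suc i)))"
  define R where "R = (\<lambda>n. \<Prod>i<n. \<rho> i)"
  have G_step: "G k = 1 + \<rho> k * G (Suc k)" for k
    unfolding G_def step[of k] \<rho>_def using nz(2)[of "Suc k"] by simp
  have partial: "G 0 = (\<Sum>n<N. R n) + R N * G N" for N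
  proof (induction N)
    case (Suc N)
    have "R N * G N = R N + R (Suc N) * G (Suc N)"
      unfolding G_step[of N] by (simp add: R_def algebra_simps)
    thus ?case using Suc by simp
  qed (simp add: R_def)
  have "summable R"
  proof (rule summable_ratio_limit)
    show "R (Suc n) = \<rho> n * R n" for n by (simp add: R_def)
    have "\<rho> \<longlonglongrightarrow> (b * 0 - a) * t * 0 / ((1 - b * 0) * (1 - t * 0))"
      unfolding \<rho>_def by (intro tendsto_intros LIMSEQ_Suc tendsto_power_0 p) auto
    thus "\<rho> \<longlonglongrightarrow> 0" by simp
  qed auto
  hence R0: "R \<longlonglongrightarrow> 0" by (rule summable_LIMSEQ_zero)
  have RG_le: "norm (R N * G N) \<le> norm (R N) * (2 * (E / \<kappa> / (1 - norm t)))" for N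
  proof -
    have "norm (1 - t * p ^ N) \<le> 2"
      using norm_triangle_ineq4[of 1 "t * p ^ N"] tp[of N] t by simp
    thus ?thesis
      unfolding G_def norm_mult[of "R N"] norm_mult[of "1 - t * p ^ N"]
      by (intro mult_left_mono mult_mono F_le) auto
  qed
  have "(\<lambda>N. R N * G N) \<longlonglongrightarrow> 0"
    by (rule tendsto_0_le[OF R0]) (rule always_eventually, rule allI, rule RG_le)
  hence "(\<lambda>N. G 0 - R N * G N) \<longlonglongrightarrow> G 0 - 0"
    by (intro tendsto_intros)
  moreover have "(\<lambda>N. G 0 - R N * G N) = (\<lambda>N. \<Sum>n<N. R n)"
    using partial by (auto simp: fun_eq_iff algebra_simps)
  ultimately have "R sums G 0" by (simp add: sums_def)
  thus ?thesis by (simp add: R_def \<rho>_def G_def F_def f_def)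
qed

section \<open>Partial fractions of the reciprocal theta product\<close>

text \<open>The coefficients of the partial fraction expansion of \<open>(q; q)\<^sub>\<infinity>\<^sup>2 / (- q; q)\<^sub>\<infinity>\<^sup>2\<close>, that is, the sequence \<open>\<alpha>\<close> of the Bailey
  pair with \<open>a = 1\<close> and \<open>x = - 1\<close>. The exponent is \<open>triangle r = r (r + 1) / 2\<close>.\<close>
definition pf_coeff :: "complex \<Rightarrow> nat \<Rightarrow> complex" where
  "pf_coeff q r = (if r = 0 then 1 else 4 * (- 1) ^ r * q ^ triangle r / (1 + q ^ r))"

lemma norm_one_plus_power_ge:
  fixes q :: complex
  assumes "norm q < 1" "r > 0"
  shows "1 - norm q \<le> norm (1 + q ^ r)"
proof -
  have "norm (- (q ^ r)) \<le> norm q"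
    using power_decreasing[of 1 r "norm q"] assms by (simp add: norm_power Suc_le_eq)
  from norm_one_minus_ge[OF this] show ?thesis by simp
qed

lemma norm_pf_coeff_le:
  assumes "norm q < 1"
  shows "norm (pf_coeff q r) \<le> 4 / (1 - norm q) * norm q ^ r"
proof (cases "r = 0")
  case True
  thus ?thesis using assms by (auto simp: pf_coeff_def pos_le_divide_eq intro: order_trans[of _ 0])
next
  case False
  have "r \<le> triangle r" using triangle_pred[of r] by linarith
  hence "norm q ^ triangle r \<le> norm q ^ r"
    using assms by (intro power_decreasing) auto
  hence "4 * norm q ^ triangle r / norm (1 + q ^ r) \<le> 4 * norm q ^ r / (1 - norm q)"
    using assms False by (intro frac_le norm_one_plus_power_ge) auto
  thus ?thesis using False by (simp add: pf_coeff_def norm_mult norm_divide norm_power)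
qed

text \<open>The case \<open>X = - 2\<close> of \<open>bailey_pair_0\<close>, where the quadratic factors are squares.\<close>
lemma pf_coeff_pair:
  assumes q: "norm q < 1"
  shows "(\<Sum>r\<le>n. pf_coeff q r / (qpoch q q (n - r) * qpoch q q (n + r))) = 1 / qpoch (- q) q n ^ 2"
proof -
  have nz: "1 + q ^ Suc r \<noteq> 0" for r
    using norm_one_plus_power_ge[OF q, of "Suc r"] q by auto
  have sq: "1 - (- 2) * q ^ r + q ^ (2 * r) = (1 + q ^ r) ^ 2" for r
    by (simp add: power2_sum power_mult[symmetric] mult.commute)
  have coeff: "(if r = 0 then 1 else (2 - (- 2)) * ((- 1) ^ r * q ^ triangle r * (1 + q ^ r)) /
      (1 - (- 2) * q ^ r + q ^ (2 * r))) = pf_coeff q r" for r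
    unfolding sq pf_coeff_def using nz[of "r - 1"] by (auto simp: power2_eq_square simp del: power_Suc)
  have "(\<Prod>i<n. 1 - (- 2) * q ^ Suc i + q ^ (2 * Suc i)) = qpoch (- q) q n ^ 2"
    unfolding sq by (simp add: qpoch_def prod_power_distrib mult.commute)
  moreover have "1 - (- 2) * q ^ Suc r + q ^ (2 * Suc r) \<noteq> 0" for r
    unfolding sq using nz[of r] by simp
  ultimately show ?thesis
    using bailey_pair_0[OF q, of "- 2" n] unfolding coeff by simp
qed

text \<open>The limit \<open>n \<rightarrow> \<infinity>\<close> of the preceding expansion.\<close>
lemma suminf_pf_coeff:
  assumes q: "norm q < 1"
  shows "(\<Sum>r. pf_coeff q r) = qpoch_inf q q ^ 2 / qpoch_inf (- q) q ^ 2"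
proof -
  define a where "a = (\<lambda>r n. if r \<le> n then pf_coeff q r / (qpoch q q (n - r) * qpoch q q (n + r)) else 0)"
  obtain k where k: "k > 0" "\<And>c n. norm c \<le> norm q \<Longrightarrow> k \<le> norm (qpoch c q n)"
    using qpoch_lower_bound[OF q] by metis
  have sum_norm: "summable (\<lambda>r. norm (pf_coeff q r))"
    using suminf_even_odd(1)[OF norm_pf_coeff_le[OF q]] q by simp
  note P = qpoch_tendsto'[OF q q] 
  have lim: "(\<lambda>n. \<Sum>r. a r n) \<longlonglongrightarrow> (\<Sum>r. pf_coeff q r / qpoch_inf q q ^ 2)"
  proof (rule tannerys_theorem[THEN conjunct2, THEN conjunct2])
    fix r
    have "(\<lambda>n. pf_coeff q r / (qpoch q q n * qpoch q q (n + (2 * r)))) \<longlonglongrightarrow>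
        pf_coeff q r / (qpoch_inf q q * qpoch_inf q q)"
      using P by (intro tendsto_intros LIMSEQ_ignore_initial_segment) auto
    moreover have "(\<lambda>n. pf_coeff q r / (qpoch q q n * qpoch q q (n + (2 * r)))) = (\<lambda>n. a r (n + r))"
      by (simp add: a_def mult_2 add_ac)
    ultimately have "(\<lambda>n. a r (n + r)) \<longlonglongrightarrow> pf_coeff q r / qpoch_inf q q ^ 2"
      by (simp add: power2_eq_square)
    thus "a r \<longlonglongrightarrow> pf_coeff q r / qpoch_inf q q ^ 2" by (rule LIMSEQ_offset)
  next
    have "norm (a r n) \<le> norm (pf_coeff q r) * (1 / (k * k))" for r n
    proof -
      have "norm (pf_coeff q r) / (norm (qpoch q q (n - r)) * norm (qpoch q q (n + r))) \<le>
          norm (pf_coeff q r) / (k * k)"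
        by (intro frac_le mult_mono k) (use k in auto)
      thus ?thesis using k by (auto simp: a_def norm_divide norm_mult)
    qed
    thus "\<forall>\<^sub>F (r, n) in at_top \<times>\<^sub>F sequentially. norm (a r n) \<le> norm (pf_coeff q r) * (1 / (k * k))"
      by (intro always_eventually) auto
    show "summable (\<lambda>r. norm (pf_coeff q r) * (1 / (k * k)))"
      by (intro summable_mult2 sum_norm)
  qed auto
  have eq: "(\<Sum>r. a r n) = 1 / qpoch (- q) q n ^ 2" for n
  proof -
    have "(\<Sum>r. a r n) = (\<Sum>r\<le>n. a r n)" by (rule suminf_finite) (auto simp: a_def)
    thus ?thesis unfolding pf_coeff_pair[OF q, symmetric] by (simp add: a_def)
  qed
  have "(\<lambda>n. 1 / qpoch (- q) q n ^ 2) \<longlonglongrightarrow> 1 / qpoch_inf (- q) q ^ 2"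
    using qpoch_tendsto'[of q "- q"] q by (intro tendsto_intros) auto
  with lim have "(\<Sum>r. pf_coeff q r / qpoch_inf q q ^ 2) = 1 / qpoch_inf (- q) q ^ 2"
    unfolding eq by (rule LIMSEQ_unique)
  thus ?thesis
    using suminf_divide[OF summable_norm_cancel[OF sum_norm], of "qpoch_inf q q ^ 2"] P(2)
    by (simp add: field_simps)
qed

section \<open>The mock theta functions as parts of one series\<close>

lemma triangle_even: "triangle (2 * r) = 2 * triangle r + r ^ 2"
  by (induction r) (simp_all add: power2_eq_square)

lemma triangle_odd: "triangle (2 * r + 1) = 2 * triangle r + (r ^ 2 + 2 * r) + 1"
  using triangle_even[of r] by simp

text \<open>Bailey's lemma with base \<open>q\<close>, \<open>a = 1\<close>, \<open>\<rho>\<^sub>1 = \<surd>q = - \<rho>\<^sub>2\<close>, hence \<open>t = - 1\<close>.\<close>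
lemma xi_R_eq:
  assumes q: "norm q < 1"
  shows "xi_R q = qpoch_inf q (q ^ 2) / (2 * qpoch_inf (q ^ 2) (q ^ 2)) * (\<Sum>r. (- 1) ^ r * pf_coeff q r)"
proof -
  note q2 = norm_square_less_1[OF q]
  define a where "a = (\<lambda>n. (- 1) ^ n * qpoch q (q ^ 2) n / qpoch (- q) q n ^ 2)"
  define w where "w = (\<lambda>i. 1 - 0 * q ^ i + (- 1) * q ^ (0 + 1 + 2 * i))"
  define \<delta> where "\<delta> = (\<lambda>n. \<Prod>i<n. (- 1) - 0 * q ^ i + q ^ (0 + 1 + 2 * i))"
  define \<beta> where "\<beta> = (\<lambda>n. \<Sum>r\<le>n. pf_coeff q r / (qpoch q q (n - r) * qpoch q q (n + r + 0)))"
  have w: "w i = 1 - (q ^ 2) ^ i * q" for i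
    by (simp add: w_def power_mult)
  have w_prod: "(\<Prod>i<n. w i) = qpoch q (q ^ 2) n" for n
    unfolding w qpoch_def ..
  have w_nz: "qpoch q (q ^ 2) n \<noteq> 0" "w n \<noteq> 0" for n
    using qpoch_nonzero[of "q ^ 2" q] norm_power_mult_less_1[of "q ^ 2" q n] q q2 by (auto simp: w)
  have \<delta>: "\<delta> n = (- 1) ^ n * qpoch q (q ^ 2) n" for n
    unfolding \<delta>_def qpoch_def
    by (induction n) (simp_all add: power_mult[symmetric] algebra_simps)
  have a_eq: "\<delta> n * \<beta> n = a n" for n
    using pf_coeff_pair[OF q, of n] by (simp add: \<delta> \<beta>_def a_def)
  have "(\<lambda>N. ((\<Sum>n<N. \<delta> n * \<beta> n) + (\<Sum>n<Suc N. \<delta> n * \<beta> n)) / 2) \<longlonglongrightarrow>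
      qpoch_inf q (q ^ 2) / (qpoch_inf q q * qpoch_inf (- 1) q) * (\<Sum>r. pf_coeff q r * (\<delta> r / (\<Prod>i<r. w i)))"
    unfolding \<delta>_def \<beta>_def w_def
  proof (rule bailey_lemma_averaged[OF q])
    show "(\<lambda>n. \<Prod>i<n. 1 - 0 * q ^ i + (- 1) * q ^ (0 + 1 + 2 * i)) \<longlonglongrightarrow> qpoch_inf q (q ^ 2)"
      using qpoch_tendsto'(1)[OF q2 q] unfolding w_prod[unfolded w_def, abs_def] by simp
    show "summable (\<lambda>r. norm (pf_coeff q r))"
      using suminf_even_odd(1)[OF norm_pf_coeff_le[OF q]] q by simp
    show "1 - 0 * q ^ i + (- 1) * q ^ (0 + 1 + 2 * i) \<noteq> 0" for i
      using w_nz(2)[of i] unfolding w_def .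
  qed auto
  moreover have "pf_coeff q r * (\<delta> r / (\<Prod>i<r. w i)) = (- 1) ^ r * pf_coeff q r" for r
    unfolding \<delta> w_prod using w_nz(1)[of r] by simp
  moreover have "qpoch_inf q q * qpoch_inf (- 1) q = 2 * qpoch_inf (q ^ 2) (q ^ 2)"
    using qpoch_inf_products[OF q] by simp
  ultimately have avg: "(\<lambda>N. ((\<Sum>n<N. a n) + (\<Sum>n<Suc N. a n)) / 2) \<longlonglongrightarrow>
      qpoch_inf q (q ^ 2) / (2 * qpoch_inf (q ^ 2) (q ^ 2)) * (\<Sum>r. (- 1) ^ r * pf_coeff q r)"
    unfolding a_eq by simp
  have "(\<lambda>n. qpoch q (q ^ 2) n / qpoch (- q) q n ^ 2) \<longlonglongrightarrow> qpoch_inf q (q ^ 2) / qpoch_inf (- q) q ^ 2"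
    using qpoch_tendsto'[of q "- q"] q by (intro tendsto_intros qpoch_tendsto' q2) auto
  from LIMSEQ_subseq_LIMSEQ[OF this, of "\<lambda>N. 2 * N + 1"]
  have "(\<lambda>N. - (qpoch q (q ^ 2) (2 * N + 1) / qpoch (- q) q (2 * N + 1) ^ 2)) \<longlonglongrightarrow>
      - (qpoch_inf q (q ^ 2) / qpoch_inf (- q) q ^ 2)"
    by (intro tendsto_minus) (simp add: o_def strict_mono_def)
  hence "(\<lambda>N. a (2 * N + 1)) \<longlonglongrightarrow> - (qpoch_inf q (q ^ 2) / qpoch_inf (- q) q ^ 2)"
    by (simp add: a_def)
  from star_sum_eq_averaged_limit[OF avg this] show ?thesis
    by (simp add: xi_R_def a_def)
qed

text \<open>Bailey's lemma with base \<open>p = q\<^sup>2\<close>, \<open>a = 1\<close>, \<open>\<rho>\<^sub>1 = q\<close> and \<open>\<rho>\<^sub>2 = \<infinity>\<close>. The resulting terms are those of the expansion of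
  \<open>(q; q)\<^sub>\<infinity>\<^sup>2 / (- q; q)\<^sub>\<infinity>\<^sup>2\<close> with even index.\<close>
lemma mu2_eq:
  assumes q: "norm q < 1"
  shows "mu2 q = qpoch_inf q (q ^ 2) / qpoch_inf (q ^ 2) (q ^ 2) * (\<Sum>r. pf_coeff q (2 * r))"
proof -
  define p where "p = q ^ 2"
  have p: "norm p < 1" using norm_square_less_1[OF q] by (simp add: p_def)
  define a where "a = (\<lambda>n. (- 1) ^ n * q ^ (n ^ 2) * qpoch q p n / qpoch (- p) p n ^ 2)"
  define w where "w = (\<lambda>i. 1 - q * p ^ i + 0 * p ^ (0 + 1 + 2 * i))"
  define \<delta> where "\<delta> = (\<lambda>n. \<Prod>i<n. 0 - q * p ^ i + p ^ (0 + 1 + 2 * i))"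
  define \<beta> where "\<beta> = (\<lambda>n. \<Sum>r\<le>n. pf_coeff p r / (qpoch p p (n - r) * qpoch p p (n + r + 0)))"
  have w_prod: "(\<Prod>i<n. w i) = qpoch q p n" for n
    by (simp add: w_def qpoch_def mult.commute)
  have w_nz: "qpoch q p n \<noteq> 0" "w n \<noteq> 0" for n
    using qpoch_nonzero[of p q] norm_power_mult_less_1[of p q n] q p by (auto simp: w_def mult.commute)
  have \<delta>: "\<delta> n = (- 1) ^ n * q ^ (n ^ 2) * qpoch q p n" for n
  proof (induction n)
    case (Suc n)
    have pn: "p ^ n = q ^ (2 * n)" "p ^ (0 + 1 + 2 * n) = q ^ 2 * (q ^ (2 * n)) ^ 2"
      by (simp_all add: p_def power_mult[symmetric] mult.commute flip: power_add)
    have "0 - q * p ^ n + p ^ (0 + 1 + 2 * n) = - (q ^ (2 * n + 1)) * (1 - p ^ n * q)"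
      unfolding pn by (simp add: power2_eq_square algebra_simps)
    moreover have "q ^ (Suc n ^ 2) = q ^ (n ^ 2) * q ^ (2 * n + 1)"
      unfolding power_add[symmetric] by (rule arg_cong[where f = "\<lambda>k. q ^ k"]) (simp add: power2_eq_square)
    ultimately show ?case using Suc by (simp add: \<delta>_def qpoch_Suc)
  qed (simp add: \<delta>_def)
  have a_eq: "\<delta> n * \<beta> n = a n" for n
    using pf_coeff_pair[OF p, of n] by (simp add: \<delta> \<beta>_def a_def)
  have "(\<lambda>N. ((\<Sum>n<N. \<delta> n * \<beta> n) + (\<Sum>n<Suc N. \<delta> n * \<beta> n)) / 2) \<longlonglongrightarrow>
      qpoch_inf q p / (qpoch_inf p p * qpoch_inf 0 p) * (\<Sum>r. pf_coeff p r * (\<delta> r / (\<Prod>i<r. w i)))"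
    unfolding \<delta>_def \<beta>_def w_def
  proof (rule bailey_lemma_averaged[OF p])
    show "(\<lambda>n. \<Prod>i<n. 1 - q * p ^ i + 0 * p ^ (0 + 1 + 2 * i)) \<longlonglongrightarrow> qpoch_inf q p"
      using qpoch_tendsto'(1)[OF p q] unfolding w_prod[unfolded w_def, abs_def] by simp
    show "summable (\<lambda>r. norm (pf_coeff p r))"
      using suminf_even_odd(1)[OF norm_pf_coeff_le[OF p]] p by simp
    show "1 - q * p ^ i + 0 * p ^ (0 + 1 + 2 * i) \<noteq> 0" for i
      using w_nz(2)[of i] unfolding w_def .
  qed auto
  moreover have "pf_coeff p r * (\<delta> r / (\<Prod>i<r. w i)) = pf_coeff q (2 * r)" for r
  proof (cases "r = 0")
    case True
    thus ?thesis by (simp add: pf_coeff_def \<delta>_def)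
  next
    case False
    have "\<delta> r / (\<Prod>i<r. w i) = (- 1) ^ r * q ^ (r ^ 2)"
      unfolding \<delta> w_prod using w_nz(1)[of r] by simp
    moreover have "q ^ triangle (2 * r) = p ^ triangle r * q ^ (r ^ 2)"
      by (simp only: triangle_even power_add p_def power_mult)
    ultimately show ?thesis
      using False by (simp add: pf_coeff_def p_def power_mult[symmetric] flip: power_mult_distrib)
  qed
  ultimately have avg: "(\<lambda>N. ((\<Sum>n<N. a n) + (\<Sum>n<Suc N. a n)) / 2) \<longlonglongrightarrow>
      qpoch_inf q p / qpoch_inf p p * (\<Sum>r. pf_coeff q (2 * r))"
    unfolding a_eq by simp
  have "summable a"
  proof (rule summable_ratio_limit)
    show "a (Suc n) = - (q ^ (2 * n) * q) * (1 - p ^ n * q) / (1 - p ^ n * (- p)) ^ 2 * a n" for n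
    proof -
      have "q ^ (Suc n ^ 2) = q ^ (n ^ 2) * (q ^ (2 * n) * q)"
        unfolding power_add[symmetric] power_Suc2[symmetric]
        by (rule arg_cong[where f = "\<lambda>k. q ^ k"]) (simp add: power2_eq_square)
      thus ?thesis by (simp add: a_def qpoch_Suc power_mult_distrib mult_ac)
    qed
    have "(\<lambda>n. - (q ^ (2 * n) * q) * (1 - p ^ n * q) / (1 - p ^ n * (- p)) ^ 2) \<longlonglongrightarrow>
        - (0 * q) * (1 - 0 * q) / (1 - 0 * (- p)) ^ 2"
      by (intro tendsto_intros tendsto_power_0 p q) auto
    thus "(\<lambda>n. - (q ^ (2 * n) * q) * (1 - p ^ n * q) / (1 - p ^ n * (- p)) ^ 2) \<longlonglongrightarrow> 0" by simp
  qed auto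
  from suminf_eq_averaged_limit[OF this avg] show ?thesis
    by (simp add: mu2_def a_def p_def)
qed

text \<open>Fine's transformation turns the defining series of \<open>A\<^sub>2(- q)\<close> into
  \<open>- q \<Sum>\<^sub>n (- 1)\<^sup>n q\<^bsup>n (n + 2)\<^esup> (q; q\<^sup>2)\<^sub>n / (- q; q\<^sup>2)\<^sub>n\<^sub>+\<^sub>1\<^sup>2\<close>, here written in the form needed for Bailey's lemma.\<close>
lemma A2_minus_second_form:
  assumes q: "norm q < 1"
  defines "p \<equiv> q ^ 2"
  defines "a \<equiv> \<lambda>n. (\<Prod>i<n. 0 - q ^ 3 * p ^ i + p ^ (1 + 1 + 2 * i)) *
     (1 / (\<Prod>i\<le>n. 1 - (- 2 * q) * p ^ i + p ^ (2 * i + 1)))"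
  shows "summable a" and "A2 (- q) = - q * (\<Sum>n. a n)"
proof -
  have p: "norm p < 1" using norm_square_less_1[OF q] by (simp add: p_def)
  define F where "F = (\<Sum>n. qpoch ((- 1) * p) p n / qpoch ((- q) * p) p n * (- q) ^ n)"
  define R where "R = (\<lambda>n. \<Prod>i<n. ((- q) * p ^ i - (- 1)) * (- q) * p ^ Suc i /
      ((1 - (- q) * p ^ Suc i) * (1 - (- q) * p ^ Suc i)))"
  have R: "R sums ((1 - (- q)) * F)"
    unfolding R_def F_def by (rule fine_transformation[OF p]) (use q in auto)
  have q1: "1 + q \<noteq> 0" using one_plus_nonzero[OF q] .
  have sq: "1 - (- 2 * q) * p ^ i + p ^ (2 * i + 1) = (1 + q * p ^ i) ^ 2" for i
    by (simp add: p_def power2_sum power_add power_mult_distrib power_mult[symmetric] mult_ac)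
  have Ra: "R n = (1 + q) ^ 2 * a n" for n
  proof (induction n)
    case 0
    show ?case using q1 sq[of 0] by (simp add: R_def a_def)
  next
    case (Suc n)
    have "((- q) * p ^ n - (- 1)) * (- q) * p ^ Suc n = 0 - q ^ 3 * p ^ n + p ^ (1 + 1 + 2 * n)"
    proof -
      define y where "y = p ^ n"
      have e: "p ^ (1 + 1 + 2 * n) = p * p * (y * y)"
        by (simp add: y_def mult_2 power_add)
      show ?thesis
        unfolding e power_Suc y_def[symmetric] by (simp add: p_def eval_nat_numeral algebra_simps)
    qed
    moreover have "(1 - (- q) * p ^ Suc n) * (1 - (- q) * p ^ Suc n) = 1 - (- 2 * q) * p ^ Suc n + p ^ (2 * Suc n + 1)"
      unfolding sq by (simp add: power2_eq_square)
    ultimately have "R (Suc n) = R n * ((0 - q ^ 3 * p ^ n + p ^ (1 + 1 + 2 * n)) /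
        (1 - (- 2 * q) * p ^ Suc n + p ^ (2 * Suc n + 1)))"
      by (simp only: R_def prod.lessThan_Suc)
    also have "\<dots> = (1 + q) ^ 2 * a (Suc n)"
      unfolding Suc by (simp only: a_def prod.lessThan_Suc prod.atMost_Suc times_divide_eq_right
          times_divide_eq_left divide_divide_eq_left mult_1_right mult.assoc)
    finally show ?case .
  qed
  have "(\<lambda>n. R n / (1 + q) ^ 2) sums ((1 - (- q)) * F / (1 + q) ^ 2)"
    by (rule sums_divide[OF R])
  moreover have "R n / (1 + q) ^ 2 = a n" for n using q1 by (simp add: Ra)
  moreover have "(1 - (- q)) * F / (1 + q) ^ 2 = F / (1 + q)" using q1 by (simp add: power2_eq_square)
  ultimately have a: "a sums (F / (1 + q))" by simp
  thus "summable a" by (rule sums_summable)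
  have "A2 (- q) = (\<Sum>n. - q / (1 + q) * (qpoch ((- 1) * p) p n / qpoch ((- q) * p) p n * (- q) ^ n))"
  proof -
    have "qpoch (- q) p (Suc n) = (1 + q) * qpoch ((- q) * p) p n" for n
      using qpoch_add[of "- q" p 1 n] by (simp add: qpoch_Suc[of "- q" p 0] mult.commute)
    thus ?thesis
      unfolding A2_def by (intro suminf_cong) (simp add: p_def[symmetric] mult_ac)
  qed
  also have "\<dots> = - q / (1 + q) * F"
    unfolding F_def by (intro suminf_mult summable_fine_series p) (use q in auto)
  also have "\<dots> = - q * (\<Sum>n. a n)"
    using a by (simp add: sums_iff)
  finally show "A2 (- q) = - q * (\<Sum>n. a n)" .
qed

text \<open>Bailey's lemma with base \<open>p = q\<^sup>2\<close>, \<open>a = p\<close>, \<open>\<rho>\<^sub>1 = q\<close> and \<open>\<rho>\<^sub>2 = \<infinity>\<close>, applied to the pair with \<open>x = - q\<close>. The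
  resulting terms are those of the expansion of \<open>(q; q)\<^sub>\<infinity>\<^sup>2 / (- q; q)\<^sub>\<infinity>\<^sup>2\<close> with odd index.\<close>
lemma A2_minus_eq:
  assumes q: "norm q < 1"
  shows "A2 (- q) = qpoch_inf q (q ^ 2) / (4 * qpoch_inf (q ^ 2) (q ^ 2)) * (\<Sum>r. pf_coeff q (2 * r + 1))"
proof -
  define p where "p = q ^ 2"
  have p: "norm p < 1" using norm_square_less_1[OF q] by (simp add: p_def)
  have q3: "norm (q ^ 3) < 1" using q by (simp add: norm_power power_less_one_iff)
  define \<alpha> where "\<alpha> = (\<lambda>r. (- 1) ^ r * p ^ triangle r * (1 - p ^ (2 * r + 1)) /
      (1 - (- 2 * q) * p ^ r + p ^ (2 * r + 1)))"
  define w where "w = (\<lambda>i. 1 - q ^ 3 * p ^ i + 0 * p ^ (1 + 1 + 2 * i))"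
  define \<delta> where "\<delta> = (\<lambda>n. \<Prod>i<n. 0 - q ^ 3 * p ^ i + p ^ (1 + 1 + 2 * i))"
  define \<beta> where "\<beta> = (\<lambda>n. \<Sum>r\<le>n. \<alpha> r / (qpoch p p (n - r) * qpoch p p (n + r + 1)))"
  define g where "g = (\<lambda>r. p ^ triangle r * q ^ (r ^ 2 + 2 * r) / (1 + q ^ (2 * r + 1)))"
  have qp: "q * p ^ r = q ^ (2 * r + 1)" for r by (simp add: p_def power_mult)
  have sq: "1 - (- 2 * q) * p ^ r + p ^ (2 * r + 1) = (1 + q ^ (2 * r + 1)) ^ 2" for r
    unfolding qp[symmetric] by (simp add: p_def power2_sum power_add power_mult_distrib power_mult[symmetric] mult_ac)
  have nz: "1 + q ^ (2 * r + 1) \<noteq> 0" for r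
    using norm_one_plus_power_ge[OF q, of "2 * r + 1"] q by auto
  have nz': "1 - q ^ (2 * r + 1) \<noteq> 0" for r
    using power_neq_1(2)[OF q order_refl, of "2 * r"] by simp
  have \<alpha>: "\<alpha> r = (- 1) ^ r * p ^ triangle r * (1 - q ^ (2 * r + 1)) / (1 + q ^ (2 * r + 1))" for r
  proof -
    have "1 - p ^ (2 * r + 1) = (1 - q ^ (2 * r + 1)) * (1 + q ^ (2 * r + 1))"
      by (simp add: p_def power_mult[symmetric] algebra_simps flip: power_add)
    thus ?thesis unfolding \<alpha>_def sq using nz[of r] by (simp add: power2_eq_square del: power_Suc)
  qed
  have p_le: "norm p ^ triangle r \<le> norm p ^ r" for r
  proof -
    have "r \<le> triangle r" using triangle_pred[of r] by linarith
    thus ?thesis using p by (intro power_decreasing) auto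
  qed
  have den: "1 - norm q \<le> norm (1 + q ^ (2 * r + 1))" for r
    by (rule norm_one_plus_power_ge[OF q]) simp
  have q_le: "norm (q ^ n) \<le> 1" for n using q by (simp add: norm_power power_le_one)
  have geo: "summable (\<lambda>r. K * norm p ^ r)" for K
    using p by (intro summable_mult summable_geometric) auto
  have "norm (\<alpha> r) \<le> 2 / (1 - norm q) * norm p ^ r" for r
  proof -
    have "norm (1 - q ^ (2 * r + 1)) \<le> 2"
      using norm_triangle_ineq4[of 1 "q ^ (2 * r + 1)"] q_le[of "2 * r + 1"] by simp
    hence "norm p ^ triangle r * norm (1 - q ^ (2 * r + 1)) / norm (1 + q ^ (2 * r + 1)) \<le>
        norm p ^ r * 2 / (1 - norm q)"
      by (intro frac_le mult_mono p_le den) (use q in auto)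
    thus ?thesis by (simp add: \<alpha> norm_mult norm_divide norm_power mult.commute)
  qed
  hence \<alpha>_summable: "summable (\<lambda>r. norm (\<alpha> r))"
    by (intro summable_comparison_test'[OF geo[of "2 / (1 - norm q)"], of 0]) (simp only: real_norm_def abs_norm_cancel)
  have "norm (g r) \<le> 1 / (1 - norm q) * norm p ^ r" for r
  proof -
    have "norm p ^ triangle r * norm (q ^ (r ^ 2 + 2 * r)) / norm (1 + q ^ (2 * r + 1)) \<le>
        norm p ^ r * 1 / (1 - norm q)"
      by (intro frac_le mult_mono p_le den q_le) (use q in auto)
    thus ?thesis by (simp add: g_def norm_mult norm_divide norm_power)
  qed
  hence g_summable: "summable g"
    by (intro summable_comparison_test'[OF geo[of "1 / (1 - norm q)"], of 0])
  have w_prod: "(\<Prod>i<n. w i) = qpoch (q ^ 3) p n" for n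
    by (simp add: w_def qpoch_def mult.commute)
  have w_nz: "qpoch (q ^ 3) p n \<noteq> 0" "w n \<noteq> 0" for n
    using qpoch_nonzero[of p "q ^ 3"] norm_power_mult_less_1[of p "q ^ 3" n] q3 p
    by (auto simp: w_def mult.commute)
  have q_shift: "(1 - q) * qpoch (q ^ 3) p n = qpoch q p (Suc n)" for n
  proof -
    have "p ^ 1 * q = q ^ 3" "qpoch q p 1 = 1 - q"
      by (simp_all add: p_def qpoch_def eval_nat_numeral)
    thus ?thesis using qpoch_add[of q p 1 n] by simp
  qed
  have \<delta>: "\<delta> n = (- 1) ^ n * q ^ (n ^ 2 + 2 * n) * qpoch q p n" for n
  proof (induction n)
    case (Suc n)
    have "0 - q ^ 3 * p ^ n + p ^ (1 + 1 + 2 * n) = - (q ^ (2 * n + 3)) * (1 - p ^ n * q)"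
    proof -
      define y where "y = p ^ n"
      have "p ^ (1 + 1 + 2 * n) = p * p * (y * y)"
        by (simp add: y_def mult_2 power_add)
      moreover have "q ^ (2 * n + 3) = q ^ 3 * y"
        unfolding y_def p_def power_add power_mult by (rule mult.commute)
      ultimately have e: "p ^ (1 + 1 + 2 * n) = p * p * (y * y)" "q ^ (2 * n + 3) = q ^ 3 * y" .
      show ?thesis
        unfolding e y_def[symmetric] by (simp add: p_def eval_nat_numeral algebra_simps)
    qed
    moreover have "q ^ (Suc n ^ 2 + 2 * Suc n) = q ^ (n ^ 2 + 2 * n) * q ^ (2 * n + 3)"
      unfolding power_add[symmetric] by (rule arg_cong[where f = "\<lambda>k. q ^ k"]) (simp add: power2_eq_square)
    moreover have "\<delta> (Suc n) = \<delta> n * (0 - q ^ 3 * p ^ n + p ^ (1 + 1 + 2 * n))"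
      by (simp add: \<delta>_def)
    ultimately show ?case using Suc by (simp add: qpoch_Suc)
  qed (simp add: \<delta>_def)
  define a where "a = (\<lambda>n. \<delta> n * \<beta> n)"
  have \<beta>: "\<beta> n = 1 / (\<Prod>i\<le>n. 1 - (- 2 * q) * p ^ i + p ^ (2 * i + 1))" for n
    unfolding \<beta>_def \<alpha>_def
  proof (rule bailey_pair_1[OF p])
    show "1 - (- 2 * q) * p ^ r + p ^ (2 * r + 1) \<noteq> 0" for r
      unfolding sq using nz[of r] by simp
  qed
  have second: "summable (\<lambda>n. \<delta> n * \<beta> n)" "A2 (- q) = - q * (\<Sum>n. \<delta> n * \<beta> n)"
    unfolding \<beta> \<delta>_def by (rule A2_minus_second_form[OF q, folded p_def])+
  have "(\<lambda>N. ((\<Sum>n<N. \<delta> n * \<beta> n) + (\<Sum>n<Suc N. \<delta> n * \<beta> n)) / 2) \<longlonglongrightarrow>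
      qpoch_inf (q ^ 3) p / (qpoch_inf p p * qpoch_inf 0 p) * (\<Sum>r. \<alpha> r * (\<delta> r / (\<Prod>i<r. w i)))"
    unfolding \<delta>_def \<beta>_def w_def
  proof (rule bailey_lemma_averaged[OF p])
    show "(\<lambda>n. \<Prod>i<n. 1 - q ^ 3 * p ^ i + 0 * p ^ (1 + 1 + 2 * i)) \<longlonglongrightarrow> qpoch_inf (q ^ 3) p"
      using qpoch_tendsto'(1)[OF p q3] unfolding w_prod[unfolded w_def, abs_def] by simp
    show "1 - q ^ 3 * p ^ i + 0 * p ^ (1 + 1 + 2 * i) \<noteq> 0" for i
      using w_nz(2)[of i] unfolding w_def .
  qed (use \<alpha>_summable in auto)
  from suminf_eq_averaged_limit[OF _ this]
  have sum_eq: "(\<Sum>n. \<delta> n * \<beta> n) = qpoch_inf (q ^ 3) p / qpoch_inf p p * (\<Sum>r. \<alpha> r * (\<delta> r / (\<Prod>i<r. w i)))"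
    using second(1) by simp
  have \<alpha>\<delta>: "\<alpha> r * (\<delta> r / (\<Prod>i<r. w i)) = (1 - q) * g r" for r
  proof -
    have "qpoch q p r / qpoch (q ^ 3) p r = (1 - q) / (1 - q ^ (2 * r + 1))"
      using q_shift[of r] w_nz(1)[of r] nz'[of r] qp[of r]
      by (simp add: qpoch_Suc field_simps del: power_Suc)
    hence eq: "\<delta> r / (\<Prod>i<r. w i) = (- 1) ^ r * q ^ (r ^ 2 + 2 * r) * ((1 - q) / (1 - q ^ (2 * r + 1)))"
      unfolding \<delta> w_prod by (simp only: times_divide_eq_right[symmetric] mult.assoc)
    have gen: "s * A * (1 - z) / (1 + z) * (s * B * ((1 - q) / (1 - z))) = (1 - q) * (A * B / (1 + z))"
      if "1 - z \<noteq> 0" "s * s = 1" for s A B z :: complex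
    proof -
      have gen: "s * A * (1 - z) / (1 + z) * (s * B * ((1 - q) / (1 - z))) =
          (s * s) * ((1 - z) / (1 - z)) * ((1 - q) * (A * B / (1 + z)))"
        by (simp add: mult_ac)
      thus ?thesis using that by simp
    qed
    show ?thesis unfolding \<alpha> eq g_def
      by (rule gen[OF nz']) (simp flip: power_mult_distrib)
  qed
  have W: "(1 - q) * qpoch_inf (q ^ 3) p = qpoch_inf q p"
  proof -
    have "(\<lambda>n. (1 - q) * qpoch (q ^ 3) p n) \<longlonglongrightarrow> (1 - q) * qpoch_inf (q ^ 3) p"
      by (intro tendsto_intros qpoch_tendsto' p q3)
    moreover have "(\<lambda>n. (1 - q) * qpoch (q ^ 3) p n) \<longlonglongrightarrow> qpoch_inf q p"
      unfolding q_shift by (intro LIMSEQ_Suc qpoch_tendsto' p q)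
    ultimately show ?thesis by (rule LIMSEQ_unique)
  qed
  have pf: "pf_coeff q (2 * r + 1) = - 4 * q * g r" for r
  proof -
    have "q ^ triangle (2 * r + 1) = q * (p ^ triangle r * q ^ (r ^ 2 + 2 * r))"
      unfolding triangle_odd p_def power_mult[symmetric] by (simp only: power_add power_one_right mult_ac)
    thus ?thesis by (simp add: pf_coeff_def g_def del: triangle_Suc)
  qed
  have "A2 (- q) = - q * (qpoch_inf (q ^ 3) p / qpoch_inf p p * ((1 - q) * (\<Sum>r. g r)))"
    unfolding second(2) sum_eq \<alpha>\<delta> using suminf_mult[OF g_summable, of "1 - q"] by simp
  also have "\<dots> = qpoch_inf q p / (4 * qpoch_inf p p) * (- 4 * q * (\<Sum>r. g r))"
    unfolding W[symmetric] by simp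
  also have "- 4 * q * (\<Sum>r. g r) = (\<Sum>r. pf_coeff q (2 * r + 1))"
    unfolding pf by (rule suminf_mult[OF g_summable, symmetric])
  finally show ?thesis by (simp add: p_def)
qed

lemma Theta_eq: "Theta m q = qpoch_inf (q ^ m) (q ^ m)"
  by (simp only: Theta_def qpoch_inf_def power_mult power_Suc2)

theorem theorem2p5:
  fixes \<tau> q :: complex
  assumes "Im \<tau> > 0" and "q = exp (2 * of_real pi * \<i> * \<tau>)"
  shows "1 / 2 * xi_R q + 2 * A2 (- q) = 1 / 4 * (Theta 1 q ^ 5 / Theta 2 q ^ 4) \<and>
         1 / 2 * xi_R q - 1 / 2 * mu2 q = - (1 / 4) * (Theta 1 q ^ 5 / Theta 2 q ^ 4) \<and>
         1 / 2 * xi_R q - 1 / 4 * mu2 q + A2 (- q) = 0"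
proof -
  have q: "norm q < 1"
    using assms by (simp add: mult_pos_pos)
  define E where "E = (\<Sum>r. pf_coeff q (2 * r))"
  define O' where "O' = (\<Sum>r. pf_coeff q (2 * r + 1))"
  define C where "C = qpoch_inf q (q ^ 2) / qpoch_inf (q ^ 2) (q ^ 2)"
  note eo = suminf_even_odd[OF norm_pf_coeff_le[OF q] norm_ge_zero q]
  have xi: "xi_R q = C / 2 * (E - O')"
    unfolding xi_R_eq[OF q] eo(3) by (simp add: C_def E_def O'_def)
  have mu: "mu2 q = C * E"
    unfolding mu2_eq[OF q] by (simp add: C_def E_def)
  have A: "A2 (- q) = C / 4 * O'"
    unfolding A2_minus_eq[OF q] by (simp add: C_def O'_def)
  have theta: "C * (E + O') = Theta 1 q ^ 5 / Theta 2 q ^ 4"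
  proof -
    define P1 where "P1 = qpoch_inf q q"
    define P2 where "P2 = qpoch_inf (q ^ 2) (q ^ 2)"
    have nz: "P1 \<noteq> 0" "P2 \<noteq> 0" 
      using qpoch_tendsto'(2)[OF q q] qpoch_tendsto'(2)[OF norm_square_less_1[OF q] norm_square_less_1[OF q]]
      by (simp_all add: P1_def P2_def)
    have O: "qpoch_inf q (q ^ 2) = P1 / P2" and M: "qpoch_inf (- q) q = P2 / P1"
      using qpoch_inf_products(1,2)[OF q] nz by (simp_all add: P1_def P2_def field_simps)
    have "E + O' = P1 ^ 2 / (P2 / P1) ^ 2"
      unfolding M[symmetric] using eo(2) suminf_pf_coeff[OF q] by (simp add: E_def O'_def P1_def)
    moreover have "C = P1 / P2 / P2" by (simp add: C_def O P2_def)
    ultimately have "C * (E + O') = P1 / P2 / P2 * (P1 ^ 2 / (P2 / P1) ^ 2)" by simp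
    also have "\<dots> = P1 ^ 5 / P2 ^ 4" using nz by (simp add: field_simps eval_nat_numeral)
    finally show ?thesis by (simp add: Theta_eq P1_def P2_def)
  qed
  show ?thesis
    unfolding theta[symmetric] xi mu A by (simp add: field_simps)
qed

end
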